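(* Let $\rho,\alpha,\beta,\gamma\in\mathbb{R}$ with $\gamma\ne-(n\pi)^2$ for all $n\in\mathbb{N}=\{0,1,2,\dots\}$, let $c_1>0$, and let $f_1,f_2,f_3:L^2(0,1)\to L^2(0,1)$ be globally Lipschitz with $f_1(0)=f_2(0)=f_3(0)=0$. Let $k,\ell$ be the kernels defined in the context. Then for consistent initial data $\tilde u_0,v_0\in L^2(0,1)$ the target system $$\tilde u_t(x,t)=\tilde u_{xx}(x,t)-(c_1+\rho)\tilde u(x,t)+\alpha v(x,t)-\alpha\int_0^xk(x,y)v(y,t)\,dy+f_1(u)(x,t)+f_2(v)(x,t)-\int_0^xk(x,y)f_2(v)(y,t)\,dy-\int_0^xk(x,y)f_1(u)(y,t)\,dy,$$ $$0=v_{xx}(x,t)-\gamma v(x,t)+\beta u(x,t)+f_3(u)(x,t),\qquad u(x,t):=\tilde u(x,t)+\int_0^x\ell(x,y)\tilde u(y,t)\,dy,$$ $$\tilde u_x(0,t)=\tilde u_x(1,t)=0,\quad v_x(0,t)=v_x(1,t)=0,\quad\tilde u(\cdot,0)=\tilde u_0,\quad v(\cdot,0)=v_0,$$ for $x\in(0,1)$, $t\ge 0$, admits a unique mild solution $(\tilde u,v)\in C([0,+\infty),L^2(0,1))\times C([0,+\infty),L^2(0,1))$.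
   Context: $f_i(u)(x,t)$ denotes $f_i(u(\cdot,t))$ evaluated at $x$. $\Delta z=z''$ with domain $\{z\in H^2(0,1):z'(0)=z'(1)=0\}$; for the given $\gamma$, $(\gamma I-\Delta)^{-1}$ is bounded on $L^2(0,1)$. Kernels: $k(x,y)$ is the unique solution on $0\le y\le x\le 1$ of $k_{yy}-k_{xx}+c_1k=0$, $k_y(x,0)=0$, $k(x,x)=-\frac12c_1x$; $\ell(x,y)$ solves $\ell_{xx}-\ell_{yy}+c_1\ell=0$, $\ell_y(x,0)=0$, $\ell(x,x)=-\frac12c_1x$. The maps $u\mapsto\tilde u=u-\int_0^xk(x,y)u(y)\,dy$ and $\tilde u\mapsto u=\tilde u+\int_0^x\ell(x,y)\tilde u(y)\,dy$ are inverse to each other. Consistent initial data: with $u_0=\tilde u_0+\int_0^x\ell(x,y)\tilde u_0(y)\,dy$, $v_0=(\gamma I-\Delta)^{-1}(\beta u_0+f_3(u_0))$. Mild solution: $v(\cdot,t)=(\gamma I-\Delta)^{-1}\big(\beta u(\cdot,t)+f_3(u(\cdot,t))\big)$ and $\tilde u(\cdot,t)=S(t)\tilde u_0+\int_0^tS(t-\tau)\Lambda(\tilde u(\cdot,\tau))\,d\tau$ for all $t\ge 0$, where $S(t)$ is the semigroup generated by $\Delta$ and $\Lambda(\tilde u)$ is the sum of all terms on the right-hand side of the $\tilde u$-equation other than $\tilde u_{xx}$, with $v$ expressed through $\tilde u$ by the preceding formula. *)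

theory Defs
  imports "HOL-Analysis.Analysis"
begin

section \<open>The real Hilbert space \<open>L\<^sup>2(0,1)\<close>\<close>

abbreviation unit_measure :: "real measure" where
  "unit_measure \<equiv> lebesgue_on {0<..<1}"

definition square_integrable :: "(real \<Rightarrow> real) \<Rightarrow> bool" where
  "square_integrable f \<longleftrightarrow>
     f \<in> borel_measurable unit_measure \<and> integrable unit_measure (\<lambda>x. (f x)\<^sup>2)"

lemma square_integrable_mult:
  assumes "square_integrable f" "square_integrable g"
  shows "integrable unit_measure (\<lambda>x. f x * g x)"
proof (rule Bochner_Integration.integrable_bound)
  show "integrable unit_measure (\<lambda>x. (f x)\<^sup>2 + (g x)\<^sup>2)"
    using assms by (simp add: square_integrable_def)
  show "(\<lambda>x. f x * g x) \<in> borel_measurable unit_measure"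
    using assms by (auto simp: square_integrable_def intro: borel_measurable_times)
  have "\<bar>f x * g x\<bar> \<le> (f x)\<^sup>2 + (g x)\<^sup>2" for x
  proof -
    have "0 \<le> (\<bar>f x\<bar> - \<bar>g x\<bar>)\<^sup>2" by simp
    then have "2 * (\<bar>f x\<bar> * \<bar>g x\<bar>) \<le> (f x)\<^sup>2 + (g x)\<^sup>2"
      by (simp add: power2_diff)
    moreover have "0 \<le> \<bar>f x\<bar> * \<bar>g x\<bar>" by simp
    ultimately have "\<bar>f x\<bar> * \<bar>g x\<bar> \<le> (f x)\<^sup>2 + (g x)\<^sup>2" by linarith
    then show ?thesis by (simp add: abs_mult)
  qed
  then show "AE x in unit_measure. norm (f x * g x) \<le> norm ((f x)\<^sup>2 + (g x)\<^sup>2)"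
    by simp
qed

lemma square_integrable_add:
  assumes "square_integrable f" "square_integrable g"
  shows "square_integrable (\<lambda>x. f x + g x)"
  using assms square_integrable_mult[OF assms]
  by (auto simp: square_integrable_def power2_sum mult.assoc intro: borel_measurable_add)

lemma square_integrable_scale:
  assumes "square_integrable f"
  shows "square_integrable (\<lambda>x. c * f x)"
  using assms by (auto simp: square_integrable_def power_mult_distrib
      intro: borel_measurable_times)

lemma square_integrable_uminus:
  assumes "square_integrable f"
  shows "square_integrable (\<lambda>x. - f x)"
  using square_integrable_scale[OF assms, of "-1"] by simp

lemma square_integrable_diff:
  assumes "square_integrable f" "square_integrable g"
  shows "square_integrable (\<lambda>x. f x - g x)"
  using square_integrable_add[OF assms(1) square_integrable_uminus[OF assms(2)]] by simp

definition l2_rel :: "(real \<Rightarrow> real) \<Rightarrow> (real \<Rightarrow> real) \<Rightarrow> bool" where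
  "l2_rel f g \<longleftrightarrow> square_integrable f \<and> square_integrable g \<and> (AE x in unit_measure. f x = g x)"

lemma l2_rel_refl_iff: "l2_rel f f \<longleftrightarrow> square_integrable f"
  by (simp add: l2_rel_def)

lemma square_integrable_zero: "square_integrable (\<lambda>x. 0)"
  by (simp add: square_integrable_def)

quotient_type l2 = "real \<Rightarrow> real" / partial: l2_rel
proof (rule part_equivpI)
  show "\<exists>f. l2_rel f f"
    using square_integrable_zero l2_rel_refl_iff by blast
  show "symp l2_rel"
    by (rule sympI) (auto simp: l2_rel_def)
  show "transp l2_rel"
    by (rule transpI) (auto simp: l2_rel_def)
qed

instantiation l2 :: real_inner
begin

lift_definition zero_l2 :: l2 is "\<lambda>x. 0"
  by (simp add: l2_rel_def square_integrable_zero)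

lift_definition plus_l2 :: "l2 \<Rightarrow> l2 \<Rightarrow> l2" is "\<lambda>f g x. f x + g x"
  by (auto simp: l2_rel_def square_integrable_add)

lift_definition minus_l2 :: "l2 \<Rightarrow> l2 \<Rightarrow> l2" is "\<lambda>f g x. f x - g x"
  by (auto simp: l2_rel_def square_integrable_diff)

lift_definition uminus_l2 :: "l2 \<Rightarrow> l2" is "\<lambda>f x. - f x"
  by (auto simp: l2_rel_def square_integrable_uminus)

lift_definition scaleR_l2 :: "real \<Rightarrow> l2 \<Rightarrow> l2" is "\<lambda>c f x. c * f x"
  by (auto simp: l2_rel_def square_integrable_scale)

lift_definition inner_l2 :: "l2 \<Rightarrow> l2 \<Rightarrow> real" is "\<lambda>f g. LINT x|unit_measure. f x * g x"
  subgoal for f f' g g'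
    by (rule integral_cong_AE)
       (auto simp: l2_rel_def square_integrable_def)
  done

definition "norm (f::l2) = sqrt (inner f f)"

definition "dist (f::l2) g = norm (f - g)"

definition "sgn (f::l2) = scaleR (inverse (norm f)) f"

definition "uniformity = (INF e\<in>{0 <..}. principal {(f::l2, g). dist f g < e})"

definition "open (U::l2 set) \<longleftrightarrow> (\<forall>f\<in>U. eventually (\<lambda>(f', g). f' = f \<longrightarrow> g \<in> U) uniformity)"

instance
proof
  fix f g h :: l2 and a b :: real
  show "f + g + h = f + (g + h)"
    by transfer (auto simp: l2_rel_def intro!: square_integrable_add simp: add.assoc)
  show "f + g = g + f"
    by transfer (auto simp: l2_rel_def intro!: square_integrable_add simp: add.commute)
  show "0 + f = f"
    by transfer (auto simp: l2_rel_def)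
  show "- f + f = 0"
    by transfer (auto simp: l2_rel_def square_integrable_zero)
  show "f - g = f + - g"
    by transfer (auto simp: l2_rel_def square_integrable_diff)
  show "a *\<^sub>R (f + g) = a *\<^sub>R f + a *\<^sub>R g"
    by transfer (auto simp: l2_rel_def distrib_left
        intro!: square_integrable_add square_integrable_scale)
  show "(a + b) *\<^sub>R f = a *\<^sub>R f + b *\<^sub>R f"
    by transfer (auto simp: l2_rel_def distrib_right
        intro!: square_integrable_add square_integrable_scale)
  show "a *\<^sub>R b *\<^sub>R f = (a * b) *\<^sub>R f"
    by transfer (auto simp: l2_rel_def mult.assoc intro!: square_integrable_scale)
  show "1 *\<^sub>R f = f"
    by transfer (auto simp: l2_rel_def)
  show "inner f g = inner g f"
    by transfer (simp add: mult.commute)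
  show "inner (f + g) h = inner f h + inner g h"
    by transfer (simp add: l2_rel_refl_iff distrib_right square_integrable_mult)
  show "inner (a *\<^sub>R f) g = a * inner f g"
    by transfer (simp add: mult.assoc)
  show "0 \<le> inner f f"
    by transfer simp
  show "inner f f = 0 \<longleftrightarrow> f = 0"
  proof transfer
    fix f assume "l2_rel f f"
    then have f: "square_integrable f" by (simp add: l2_rel_refl_iff)
    have "(LINT x|unit_measure. f x * f x) = 0 \<longleftrightarrow> (AE x in unit_measure. f x * f x = 0)"
      by (rule integral_nonneg_eq_0_iff_AE) (auto intro: square_integrable_mult f)
    then show "(LINT x|unit_measure. f x * f x) = 0 \<longleftrightarrow> l2_rel f (\<lambda>x. 0)"
      using f by (simp add: l2_rel_def square_integrable_zero)
  qed
qed (simp_all add: norm_l2_def dist_l2_def sgn_l2_def uniformity_l2_def open_l2_def)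

end

lemma square_integrable_rep: "square_integrable (rep_l2 f)"
  using Quotient3_rep_reflp[OF Quotient3_l2] l2_rel_refl_iff by blast

lemma rep_abs_l2:
  assumes "square_integrable f"
  shows "AE x in unit_measure. rep_l2 (abs_l2 f) x = f x"
  using Quotient3_rep_abs[OF Quotient3_l2, of f] assms
  by (simp add: l2_rel_refl_iff) (simp add: l2_rel_def)

lemma abs_rep_l2 [simp]: "abs_l2 (rep_l2 f) = f"
  by (rule Quotient3_abs_rep[OF Quotient3_l2])

lemma inner_abs_l2:
  assumes "square_integrable f" "square_integrable g"
  shows "inner (abs_l2 f) (abs_l2 g) = (LINT x|unit_measure. f x * g x)"
  using assms by (simp add: inner_l2.abs_eq l2_rel_refl_iff)

lemma norm_abs_l2:
  assumes "square_integrable f"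
  shows "(norm (abs_l2 f))\<^sup>2 = (LINT x|unit_measure. (f x)\<^sup>2)"
  using inner_abs_l2[OF assms assms] by (simp add: power2_norm_eq_inner) (simp add: power2_eq_square)

lemma minus_abs_l2:
  assumes "square_integrable f" "square_integrable g"
  shows "abs_l2 f - abs_l2 g = abs_l2 (\<lambda>x. f x - g x)"
  using assms by (simp add: minus_l2.abs_eq l2_rel_refl_iff)

lemma square_integrable_L1:
  assumes f: "square_integrable f"
  shows "integrable unit_measure f"
    and "(LINT x|unit_measure. \<bar>f x\<bar>) \<le> sqrt (LINT x|unit_measure. (f x)\<^sup>2)"
proof -
  have one: "square_integrable (\<lambda>x. 1)"
    by (simp add: square_integrable_def integrable_restrict_space)
  show "integrable unit_measure f"
    using square_integrable_mult[OF f one] by simp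
  have f': "square_integrable (\<lambda>x. \<bar>f x\<bar>)"
    using f by (auto simp: square_integrable_def)
  have "\<bar>inner (abs_l2 (\<lambda>x. \<bar>f x\<bar>)) (abs_l2 (\<lambda>x. 1))\<bar>
      \<le> norm (abs_l2 (\<lambda>x. \<bar>f x\<bar>)) * norm (abs_l2 (\<lambda>x. 1))"
    by (rule Cauchy_Schwarz_ineq2)
  moreover have "norm (abs_l2 (\<lambda>x. 1)) = 1"
    using norm_abs_l2[OF one] norm_ge_zero[of "abs_l2 (\<lambda>x. 1)"]
    by (auto simp: measure_restrict_space power2_eq_1_iff)
  moreover have "norm (abs_l2 (\<lambda>x. \<bar>f x\<bar>)) = sqrt (LINT x|unit_measure. (f x)\<^sup>2)"
    using norm_abs_l2[OF f'] by (simp add: real_sqrt_unique)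
  ultimately show "(LINT x|unit_measure. \<bar>f x\<bar>) \<le> sqrt (LINT x|unit_measure. (f x)\<^sup>2)"
    by (simp add: inner_abs_l2[OF f' one])
qed

instance l2 :: banach
proof
  fix X :: "nat \<Rightarrow> l2"
  assume "Cauchy X"
  then have "\<forall>j. \<exists>N. \<forall>m\<ge>N. \<forall>n\<ge>N. norm (X m - X n) < (1/2) ^ j"
    by (simp add: Cauchy_iff)
  then obtain N where N: "\<And>j m n. N j \<le> m \<Longrightarrow> N j \<le> n \<Longrightarrow> norm (X m - X n) < (1/2) ^ j"
    by metis
  define r where "r n = (\<Sum>i\<le>n. N i)" for n
  have rN: "N j \<le> r n" if "j \<le> n" for j n
    unfolding r_def using that by (intro member_le_sum) auto
  define g where "g n = rep_l2 (X (r n))" for n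
  have g: "square_integrable (g n)" for n
    unfolding g_def by (rule square_integrable_rep)
  define d where "d n x = g (Suc n) x - g n x" for n x
  have d: "square_integrable (d n)" for n
    unfolding d_def by (intro square_integrable_diff g)
  have dX: "abs_l2 (d n) = X (r (Suc n)) - X (r n)" for n
    using minus_abs_l2[OF g g, of "Suc n" n] by (simp add: g_def d_def[abs_def])
  have d_le: "(LINT x|unit_measure. \<bar>d n x\<bar>) \<le> (1/2) ^ n" for n
  proof -
    have "(LINT x|unit_measure. \<bar>d n x\<bar>) \<le> norm (X (r (Suc n)) - X (r n))"
      using square_integrable_L1(2)[OF d, of n] norm_abs_l2[OF d, of n, symmetric] dX[of n]
      by simp
    also have "\<dots> < (1/2) ^ n"
      by (intro N rN) auto
    finally show ?thesis by simp
  qed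
  have dmeas [measurable]: "d n \<in> borel_measurable unit_measure" for n
    using d by (simp add: square_integrable_def)
  have gmeas [measurable]: "g n \<in> borel_measurable unit_measure" for n
    using g by (simp add: square_integrable_def)
  have "(\<integral>\<^sup>+x. (\<Sum>n. ennreal \<bar>d n x\<bar>) \<partial>unit_measure) = (\<Sum>n. \<integral>\<^sup>+x. ennreal \<bar>d n x\<bar> \<partial>unit_measure)"
    by (intro nn_integral_suminf) measurable
  also have "\<dots> \<le> (\<Sum>n. ennreal ((1/2) ^ n))"
  proof (intro suminf_le)
    fix n
    have "(\<integral>\<^sup>+x. ennreal \<bar>d n x\<bar> \<partial>unit_measure) = ennreal (LINT x|unit_measure. \<bar>d n x\<bar>)"
      by (intro nn_integral_eq_integral)
         (auto intro: integrable_abs square_integrable_L1(1) d)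
    also have "\<dots> \<le> ennreal ((1/2) ^ n)"
      by (intro ennreal_leI d_le)
    finally show "(\<integral>\<^sup>+x. ennreal \<bar>d n x\<bar> \<partial>unit_measure) \<le> ennreal ((1/2) ^ n)" .
  qed auto
  also have "\<dots> = ennreal (\<Sum>n. (1/2) ^ n)"
    by (intro suminf_ennreal2) (auto intro: summable_geometric)
  also have "\<dots> < \<infinity>" by simp
  finally have "(\<integral>\<^sup>+x. (\<Sum>n. ennreal \<bar>d n x\<bar>) \<partial>unit_measure) \<noteq> \<infinity>" by simp
  then have "AE x in unit_measure. (\<Sum>n. ennreal \<bar>d n x\<bar>) \<noteq> \<infinity>"
    by (intro nn_integral_noteq_infinite) measurable
  then have lim: "AE x in unit_measure. (\<lambda>n. g n x) \<longlonglongrightarrow> lim (\<lambda>n. g n x)"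
  proof eventually_elim
    case (elim x)
    then have "summable (\<lambda>n. \<bar>d n x\<bar>)"
      by (intro summable_suminf_not_top) (auto simp: top_ennreal_def)
    then have "summable (\<lambda>n. d n x)"
      by (rule summable_rabs_cancel)
    then have "convergent (\<lambda>n. \<Sum>i<n. d i x)"
      by (simp add: summable_iff_convergent)
    moreover have "(\<Sum>i<n. d i x) = g n x - g 0 x" for n
      unfolding d_def by (rule sum_lessThan_telescope)
    ultimately have "convergent (\<lambda>n. g n x - g 0 x)" by simp
    then have "convergent (\<lambda>n. (g n x - g 0 x) + g 0 x)"
      by (intro convergent_add convergent_const)
    then show ?case by (simp add: convergent_LIMSEQ_iff)
  qed
  define F where "F x = lim (\<lambda>n. g n x)" for x
  have Fmeas [measurable]: "F \<in> borel_measurable unit_measure"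
    unfolding F_def by measurable
  have key: "square_integrable (\<lambda>x. rep_l2 (X m) x - F x) \<and>
      norm (abs_l2 (\<lambda>x. rep_l2 (X m) x - F x)) \<le> (1/2) ^ j" if m: "N j \<le> m" for m j
  proof -
    have Xmeas [measurable]: "rep_l2 (X m) \<in> borel_measurable unit_measure"
      using square_integrable_rep by (simp add: square_integrable_def)
    have "(\<integral>\<^sup>+x. ennreal ((rep_l2 (X m) x - F x)\<^sup>2) \<partial>unit_measure)
        = (\<integral>\<^sup>+x. liminf (\<lambda>n. ennreal ((rep_l2 (X m) x - g n x)\<^sup>2)) \<partial>unit_measure)"
    proof (intro nn_integral_cong_AE)
      show "AE x in unit_measure. ennreal ((rep_l2 (X m) x - F x)\<^sup>2)
          = liminf (\<lambda>n. ennreal ((rep_l2 (X m) x - g n x)\<^sup>2))"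
        using lim
      proof eventually_elim
        case (elim x)
        then have "(\<lambda>n. ennreal ((rep_l2 (X m) x - g n x)\<^sup>2))
            \<longlonglongrightarrow> ennreal ((rep_l2 (X m) x - F x)\<^sup>2)"
          unfolding F_def by (intro tendsto_intros)
        then show ?case
          by (intro lim_imp_Liminf[symmetric]) simp_all
      qed
    qed
    also have "\<dots> \<le> liminf (\<lambda>n. \<integral>\<^sup>+x. ennreal ((rep_l2 (X m) x - g n x)\<^sup>2) \<partial>unit_measure)"
      by (intro nn_integral_liminf) measurable
    also have "\<dots> \<le> limsup (\<lambda>n. \<integral>\<^sup>+x. ennreal ((rep_l2 (X m) x - g n x)\<^sup>2) \<partial>unit_measure)"
      by (intro Liminf_le_Limsup) simp
    also have "\<dots> \<le> ennreal (((1/2) ^ j)\<^sup>2)"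
    proof (intro Limsup_bounded eventually_sequentiallyI)
      fix n assume "j \<le> n"
      let ?h = "\<lambda>x. rep_l2 (X m) x - g n x"
      have h: "square_integrable ?h"
        by (intro square_integrable_diff square_integrable_rep g)
      have "(\<integral>\<^sup>+x. ennreal ((?h x)\<^sup>2) \<partial>unit_measure) = ennreal (LINT x|unit_measure. (?h x)\<^sup>2)"
        using h by (intro nn_integral_eq_integral) (auto simp: square_integrable_def)
      also have "(LINT x|unit_measure. (?h x)\<^sup>2) = (norm (abs_l2 ?h))\<^sup>2"
        by (rule norm_abs_l2[OF h, symmetric])
      also have "abs_l2 ?h = X m - X (r n)"
        using minus_abs_l2[OF square_integrable_rep g, of "X m" n] by (simp add: g_def)
      also have "ennreal ((norm (X m - X (r n)))\<^sup>2) \<le> ennreal (((1/2) ^ j)\<^sup>2)"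
        using N[OF m rN[OF \<open>j \<le> n\<close>]] by (intro ennreal_leI power_mono) auto
      finally show "(\<integral>\<^sup>+x. ennreal ((?h x)\<^sup>2) \<partial>unit_measure) \<le> ennreal (((1/2) ^ j)\<^sup>2)" .
    qed
    finally have le: "(\<integral>\<^sup>+x. ennreal ((rep_l2 (X m) x - F x)\<^sup>2) \<partial>unit_measure)
        \<le> ennreal (((1/2) ^ j)\<^sup>2)" .
    then have "(\<integral>\<^sup>+x. ennreal ((rep_l2 (X m) x - F x)\<^sup>2) \<partial>unit_measure) < \<infinity>"
      by (rule le_less_trans) simp
    then have "integrable unit_measure (\<lambda>x. (rep_l2 (X m) x - F x)\<^sup>2)"
      by (intro integrableI_nonneg) auto
    then have sq: "square_integrable (\<lambda>x. rep_l2 (X m) x - F x)"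
      by (auto simp: square_integrable_def intro: borel_measurable_diff)
    have "ennreal (LINT x|unit_measure. (rep_l2 (X m) x - F x)\<^sup>2) \<le> ennreal (((1/2) ^ j)\<^sup>2)"
      using le sq by (subst nn_integral_eq_integral[symmetric]) (auto simp: square_integrable_def)
    then have "(norm (abs_l2 (\<lambda>x. rep_l2 (X m) x - F x)))\<^sup>2 \<le> ((1/2) ^ j)\<^sup>2"
      by (simp add: norm_abs_l2[OF sq] ennreal_le_iff)
    then have "norm (abs_l2 (\<lambda>x. rep_l2 (X m) x - F x)) \<le> (1/2) ^ j"
      by (rule power2_le_imp_le) simp
    with sq show ?thesis by simp
  qed
  have Fsq: "square_integrable F"
    using square_integrable_diff[OF square_integrable_rep conjunct1[OF key[OF order_refl]],
        of "X (N 0)" 0] by simp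
  have dist: "norm (X m - abs_l2 F) \<le> (1/2) ^ j" if "N j \<le> m" for m j
    using key[OF that] minus_abs_l2[OF square_integrable_rep Fsq, of "X m"] by simp
  have "X \<longlonglongrightarrow> abs_l2 F"
  proof (rule LIMSEQ_I)
    fix e :: real assume "0 < e"
    then obtain j where "(1/2) ^ j < e"
      using real_arch_pow_inv[of e "1/2"] by auto
    then show "\<exists>no. \<forall>m\<ge>no. norm (X m - abs_l2 F) < e"
      using dist[of j] by (intro exI[of _ "N j"]) force
  qed
  then show "convergent X"
    by (rule convergentI)
qed


section \<open>The Neumann Laplacian\<close>

text \<open>Weak derivatives are tested against \<open>C\<^sup>1\<close> functions with compact support in \<open>(0,1)\<close>.\<close>

definition test_function :: "(real \<Rightarrow> real) \<Rightarrow> bool" where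
  "test_function \<phi> \<longleftrightarrow> \<phi> C1_differentiable_on UNIV \<and> closure {x. \<phi> x \<noteq> 0} \<subseteq> {0<..<1}"

definition weak_derivative :: "l2 \<Rightarrow> l2 \<Rightarrow> bool" where
  "weak_derivative z w \<longleftrightarrow> (\<forall>\<phi>. test_function \<phi> \<longrightarrow>
     (LINT x|unit_measure. rep_l2 z x * deriv \<phi> x) = - (LINT x|unit_measure. rep_l2 w x * \<phi> x))"

definition wderiv :: "l2 \<Rightarrow> l2" where
  "wderiv z = (THE w. weak_derivative z w)"

definition H1 :: "l2 set" where
  "H1 = {z. \<exists>w. weak_derivative z w}"

definition H2 :: "l2 set" where
  "H2 = {z \<in> H1. wderiv z \<in> H1}"

text \<open>The boundary value at \<open>a\<close> is that of the representative that is continuous on \<open>[0,1]\<close>.\<close>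

definition has_boundary_value :: "l2 \<Rightarrow> real \<Rightarrow> real \<Rightarrow> bool" where
  "has_boundary_value z a b \<longleftrightarrow>
     (\<exists>\<phi>. continuous_on {0..1} \<phi> \<and> (AE x in unit_measure. rep_l2 z x = \<phi> x) \<and> \<phi> a = b)"

definition neumann_domain :: "l2 set" where
  "neumann_domain =
     {z \<in> H2. has_boundary_value (wderiv z) 0 0 \<and> has_boundary_value (wderiv z) 1 0}"

definition neumann_laplacian :: "l2 \<Rightarrow> l2" where
  "neumann_laplacian z = wderiv (wderiv z)"

definition neumann_resolvent :: "real \<Rightarrow> l2 \<Rightarrow> l2" where
  "neumann_resolvent \<gamma> = inv_into neumann_domain (\<lambda>z. \<gamma> *\<^sub>R z - neumann_laplacian z)"


section \<open>Strongly continuous semigroups\<close>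

text \<open>Only the values \<open>S t\<close> with \<open>t \<ge> 0\<close> are meaningful.\<close>

definition C0_semigroup :: "(real \<Rightarrow> 'a \<Rightarrow> 'a::real_normed_vector) \<Rightarrow> bool" where
  "C0_semigroup S \<longleftrightarrow>
     (\<forall>t\<ge>0. bounded_linear (S t)) \<and>
     (\<forall>z. S 0 z = z) \<and>
     (\<forall>s\<ge>0. \<forall>t\<ge>0. \<forall>z. S (s + t) z = S s (S t z)) \<and>
     (\<forall>z. ((\<lambda>t. S t z) \<longlongrightarrow> z) (at_right 0))"

definition generated_by ::
    "(real \<Rightarrow> 'a \<Rightarrow> 'a::real_normed_vector) \<Rightarrow> 'a set \<Rightarrow> ('a \<Rightarrow> 'a) \<Rightarrow> bool" where
  "generated_by S D A \<longleftrightarrow> C0_semigroup S \<and>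
     (\<forall>z w. ((\<lambda>h. (S h z - z) /\<^sub>R h) \<longlongrightarrow> w) (at_right 0) \<longleftrightarrow> z \<in> D \<and> w = A z)"


section \<open>Backstepping kernels\<close>

definition triangle :: "(real \<times> real) set" where
  "triangle = {(x, y). 0 \<le> y \<and> y \<le> x \<and> x \<le> 1}"

definition has_partials_on_triangle ::
    "(real \<Rightarrow> real \<Rightarrow> real) \<Rightarrow> (real \<Rightarrow> real \<Rightarrow> real) \<Rightarrow> (real \<Rightarrow> real \<Rightarrow> real) \<Rightarrow> bool" where
  "has_partials_on_triangle k kx ky \<longleftrightarrow>
     (\<forall>(x, y)\<in>triangle.
        ((\<lambda>(x, y). k x y) has_derivative (\<lambda>(a, b). kx x y * a + ky x y * b))
          (at (x, y) within triangle)) \<and>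
     continuous_on triangle (\<lambda>(x, y). kx x y) \<and> continuous_on triangle (\<lambda>(x, y). ky x y)"

text \<open>Both kernels are classical solutions, twice continuously differentiable up to the boundary
  of the triangle; their values off the triangle play no role.\<close>

definition direct_kernel :: "real \<Rightarrow> (real \<Rightarrow> real \<Rightarrow> real) \<Rightarrow> bool" where
  "direct_kernel c k \<longleftrightarrow>
     (\<exists>kx ky kxx kxy kyx kyy.
        has_partials_on_triangle k kx ky \<and>
        has_partials_on_triangle kx kxx kxy \<and>
        has_partials_on_triangle ky kyx kyy \<and>
        (\<forall>(x, y)\<in>triangle. kyy x y - kxx x y + c * k x y = 0) \<and>
        (\<forall>x\<in>{0..1}. ky x 0 = 0) \<and>
        (\<forall>x\<in>{0..1}. k x x = - (1/2) * c * x))"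

definition inverse_kernel :: "real \<Rightarrow> (real \<Rightarrow> real \<Rightarrow> real) \<Rightarrow> bool" where
  "inverse_kernel c l \<longleftrightarrow>
     (\<exists>lx ly lxx lxy lyx lyy.
        has_partials_on_triangle l lx ly \<and>
        has_partials_on_triangle lx lxx lxy \<and>
        has_partials_on_triangle ly lyx lyy \<and>
        (\<forall>(x, y)\<in>triangle. lxx x y - lyy x y + c * l x y = 0) \<and>
        (\<forall>x\<in>{0..1}. ly x 0 = 0) \<and>
        (\<forall>x\<in>{0..1}. l x x = - (1/2) * c * x))"

text \<open>The integral does not depend on the chosen representative of \<open>z\<close>. For kernels bounded and
  measurable on the triangle the result is square integrable, so \<^const>\<open>abs_l2\<close> is meaningful.\<close>

definition volterra :: "(real \<Rightarrow> real \<Rightarrow> real) \<Rightarrow> l2 \<Rightarrow> l2" where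
  "volterra k z = abs_l2 (\<lambda>x. LINT y:{0<..<x}|lebesgue. k x y * rep_l2 z y)"


section \<open>The target system\<close>

definition original_state :: "(real \<Rightarrow> real \<Rightarrow> real) \<Rightarrow> l2 \<Rightarrow> l2" where
  "original_state l ut = ut + volterra l ut"

definition elliptic_state ::
    "real \<Rightarrow> real \<Rightarrow> (l2 \<Rightarrow> l2) \<Rightarrow> (real \<Rightarrow> real \<Rightarrow> real) \<Rightarrow> l2 \<Rightarrow> l2" where
  "elliptic_state \<beta> \<gamma> f3 l ut =
     (let u = original_state l ut in neumann_resolvent \<gamma> (\<beta> *\<^sub>R u + f3 u))"

definition target_nonlinearity ::
    "real \<Rightarrow> real \<Rightarrow> real \<Rightarrow> real \<Rightarrow> real \<Rightarrow> (l2 \<Rightarrow> l2) \<Rightarrow> (l2 \<Rightarrow> l2) \<Rightarrow> (l2 \<Rightarrow> l2) \<Rightarrow>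
     (real \<Rightarrow> real \<Rightarrow> real) \<Rightarrow> (real \<Rightarrow> real \<Rightarrow> real) \<Rightarrow> l2 \<Rightarrow> l2" where
  "target_nonlinearity \<rho> \<alpha> \<beta> \<gamma> c1 f1 f2 f3 k l ut =
     (let u = original_state l ut;
          v = elliptic_state \<beta> \<gamma> f3 l ut
      in - (c1 + \<rho>) *\<^sub>R ut + \<alpha> *\<^sub>R v - \<alpha> *\<^sub>R volterra k v
         + f1 u + f2 v - volterra k (f2 v) - volterra k (f1 u))"

text \<open>The \<open>L\<^sup>2\<close>-valued integral has a continuous integrand for every continuous \<open>ut\<close> as soon as
  \<open>\<Lambda>\<close> is continuous, so all notions of vector integral agree on it.\<close>

definition mild_solution ::
    "(real \<Rightarrow> l2 \<Rightarrow> l2) \<Rightarrow> (l2 \<Rightarrow> l2) \<Rightarrow> (l2 \<Rightarrow> l2) \<Rightarrow> l2 \<Rightarrow> (real \<Rightarrow> l2) \<Rightarrow> (real \<Rightarrow> l2) \<Rightarrow> bool" where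
  "mild_solution S \<Lambda> E ut0 ut v \<longleftrightarrow>
     continuous_on {0..} ut \<and> continuous_on {0..} v \<and>
     (\<forall>t\<ge>0. v t = E (ut t)) \<and>
     (\<forall>t\<ge>0. ut t = S t ut0 + integral {0..t} (\<lambda>\<tau>. S (t - \<tau>) (\<Lambda> (ut \<tau>))))"

end

theory Submission
  imports Defs
begin

text \<open>
  The resolvent \<open>(\<gamma> I - \<Delta>)\<inverse>\<close> is computed explicitly: an \<open>L\<^sup>2\<close> function has weak derivative \<open>w\<close> iff
  it is almost everywhere a constant plus the primitive of \<open>w\<close>, so the Neumann problem is solved by variation of
  constants with the fundamental solutions of \<open>z'' = \<gamma> z\<close>, and the solution is unique because \<open>\<gamma>\<close> is not an
  eigenvalue. This makes the resolvent bounded; Volterra operators with continuous kernels are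
  bounded as well, so the nonlinearity \<open>\<Lambda>\<close> is globally Lipschitz on \<open>L\<^sup>2\<close>. By the uniform boundedness
  principle a strongly continuous semigroup is bounded on compact time intervals, and Picard
  iteration of Duhamel's formula in the weighted norm \<open>sup exp (- a t) \<parallel>u t\<parallel>\<close> converges to the unique
  mild solution.
\<close>

section \<open>Integration over the unit interval\<close>

text \<open>Elements of \<open>l2\<close> are classes, and \<open>rep_l2\<close> picks
  representatives that are merely Lebesgue measurable and on which algebraic identities hold only
  almost everywhere. Wherever integrations are exchanged or a parameter integral must be measurable,
  the representative is therefore traded for a Borel one. Moreover \<open>wderiv\<close> is a
  definite description and \<open>neumann_resolvent\<close> a chosen preimage, so nothing can be
  computed from them before weak derivatives are known to be unique, boundary values to be well
  defined and \<open>\<gamma> I - \<Delta>\<close> to be injective on \<open>neumann_domain\<close>.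
  Primitives settle this because they are continuous: the uniqueness question becomes one about a
  classical linear ODE.

  For the semigroup, the operator bound on \<open>[0, T]\<close>, and with it the weight
  \<open>a\<close>, depends on \<open>T\<close>. The Picard iterates do not, so the uniform limits
  on the various intervals are restrictions of one function on the half-line.\<close>

lemma AE_unit_iff:
  "(AE x in unit_measure. P x) \<longleftrightarrow> (AE x in lborel. x \<in> {0<..<1} \<longrightarrow> P x)"
  by (subst AE_restrict_space_iff) (auto simp: AE_completion_iff)

lemma set_absolutely_integrable_unit:
  fixes f :: "real \<Rightarrow> real"
  assumes "integrable unit_measure f"
  shows "f absolutely_integrable_on {0<..<1}"
  using assms unfolding set_integrable_def
  by (subst (asm) integrable_restrict_space) (auto simp: integrable_completion)

lemma absolutely_integrable_unit:
  fixes f :: "real \<Rightarrow> real"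
  assumes "integrable unit_measure f"
  shows "f absolutely_integrable_on {0..1}"
  using set_absolutely_integrable_unit[OF assms] absolutely_integrable_on_open_interval[of 0 1 f]
  by (simp add: box_real cbox_interval)

lemma integral_unit_eq:
  fixes f :: "real \<Rightarrow> real"
  assumes "integrable unit_measure f"
  shows "(LINT x|unit_measure. f x) = integral {0..1} f"
proof -
  have "(LINT x|unit_measure. f x) = (LINT x:{0<..<1}|lebesgue. f x)"
    unfolding set_lebesgue_integral_def by (rule integral_restrict_space) auto
  also have "\<dots> = integral {0<..<1} f"
    by (intro set_lebesgue_integral_eq_integral set_absolutely_integrable_unit assms)
  also have "\<dots> = integral {0..1} f"
    using integral_open_interval_real[of 0 1 f] by simp
  finally show ?thesis .
qed

lemma integral_unit_lborel:
  fixes g :: "real \<Rightarrow> real"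
  assumes g: "g \<in> borel_measurable borel" and g0: "\<And>x. x \<notin> {0<..<1} \<Longrightarrow> g x = 0"
  shows "integrable unit_measure g \<longleftrightarrow> integrable lborel g"
    and "(LINT x|unit_measure. g x) = (LINT x|lborel. g x)"
proof -
  have eq: "(\<lambda>x. indicator {0<..<1} x *\<^sub>R g x) = g"
    using g0 by (auto simp: indicator_def fun_eq_iff)
  have "integrable unit_measure g \<longleftrightarrow> integrable lebesgue (\<lambda>x. indicator {0<..<1} x *\<^sub>R g x)"
    by (rule integrable_restrict_space) auto
  then show "integrable unit_measure g \<longleftrightarrow> integrable lborel g"
    unfolding eq using g by (simp add: integrable_completion)
  have "(LINT x|unit_measure. g x) = (LINT x|lebesgue. indicator {0<..<1} x *\<^sub>R g x)"
    by (rule integral_restrict_space) auto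
  then show "(LINT x|unit_measure. g x) = (LINT x|lborel. g x)"
    unfolding eq using g by (simp add: integral_completion)
qed

text \<open>The bridge from almost everywhere statements about representatives to integrals over
  \<open>[0, x]\<close>. It is the reason why primitives and Volterra integrals depend on the class
  only.\<close>

lemma AE_unit_integral_cong:
  fixes f g :: "real \<Rightarrow> real"
  assumes "AE x in unit_measure. f x = g x" and "x \<le> 1"
  shows "integral {0..x} f = integral {0..x} g"
proof -
  obtain N where N: "N \<in> null_sets lborel" "{x. \<not> (x \<in> {0<..<1} \<longrightarrow> f x = g x)} \<subseteq> N"
    using assms(1)[unfolded AE_unit_iff] unfolding eventually_ae_filter by auto
  have "negligible N"
    using N(1) by (simp add: negligible_iff_null_sets null_sets_completionI)
  \<comment> \<open>\<open>unit_measure\<close> does not see the end points 0 and 1, where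
    representatives are arbitrary; they join the exceptional set.\<close>
  then have "negligible (N \<union> {0, 1})" by (intro negligible_Un) auto
  then show ?thesis
  proof (rule integral_spike)
    fix y assume "y \<in> {0..x} - (N \<union> {0, 1})"
    then have "y \<in> {0<..<1}" "y \<notin> N" using assms(2) by auto
    then show "g y = f y" using N(2) by auto
  qed
qed

lemma AE_rep_l2_eq:
  assumes "z = abs_l2 f" "square_integrable f"
  shows "AE x in unit_measure. rep_l2 z x = f x"
  using rep_abs_l2 assms by simp

text \<open>Borel measurability is what product measurability and Fubini require, and vanishing off
  the interval turns integrals over \<open>unit_measure\<close> into integrals over
  \<open>lborel\<close>. Every Lebesgue measurable function agrees almost everywhere with a Borel
  one; cutting it off outside the interval changes nothing in the class.\<close>

lemma l2_borel_rep:
  obtains g where "g \<in> borel_measurable borel" "square_integrable g" "z = abs_l2 g"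
    "AE x in unit_measure. rep_l2 z x = g x" "\<And>x. x \<notin> {0<..<1} \<Longrightarrow> g x = 0"
proof -
  let ?f = "\<lambda>x. indicator {0<..<1} x * rep_l2 z x"
  have sq: "square_integrable (rep_l2 z)" by (rule square_integrable_rep)
  have "rep_l2 z \<in> borel_measurable unit_measure" using sq by (simp add: square_integrable_def)
  then have "?f \<in> borel_measurable (completion lborel)"
    by (subst (asm) borel_measurable_restrict_space_iff) (auto simp: mult.commute)
  then obtain h where h: "h \<in> borel_measurable lborel" "AE x in lborel. ?f x = h x"
    using completion_ex_borel_measurable_real by blast
  define g where "g x = indicator {0<..<1} x * h x" for x
  have gm: "g \<in> borel_measurable borel" using h(1) unfolding g_def by measurable
  have ae: "AE x in unit_measure. rep_l2 z x = g x"
    unfolding AE_unit_iff using h(2) by eventually_elim (auto simp: g_def)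
  have gmu: "g \<in> borel_measurable unit_measure"
    using gm by (intro measurable_restrict_space1 measurable_completion) simp
  have "integrable unit_measure (\<lambda>x. (g x)\<^sup>2)"
    using sq gmu ae
    by (subst integrable_cong_AE[where g = "\<lambda>x. (rep_l2 z x)\<^sup>2"]) (auto simp: square_integrable_def)
  then have sg: "square_integrable g" using gmu by (simp add: square_integrable_def)
  have "abs_l2 (rep_l2 z) = abs_l2 g"
    using Quotient3_rel_abs[OF Quotient3_l2, of "rep_l2 z" g] sq sg ae by (simp add: l2_rel_def)
  then have "z = abs_l2 g" by simp
  moreover have "g x = 0" if "x \<notin> {0<..<1}" for x using that by (simp add: g_def)
  ultimately show ?thesis using that[of g] gm sg ae by metis
qed

lemma l2_eqI:
  assumes "AE x in unit_measure. rep_l2 z x = rep_l2 w x"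
  shows "z = w"
proof -
  have "l2_rel (rep_l2 z) (rep_l2 w)"
    using assms by (simp add: l2_rel_def square_integrable_rep)
  then show ?thesis using Quotient3_rel_abs[OF Quotient3_l2] by fastforce
qed

section \<open>Representatives of sums, differences and multiples; bounded and continuous
  functions\<close>

lemma rep_l2_plus: "AE x in unit_measure. rep_l2 (a + b) x = rep_l2 a x + rep_l2 b x"
proof (rule AE_rep_l2_eq)
  show "a + b = abs_l2 (\<lambda>x. rep_l2 a x + rep_l2 b x)"
    using plus_l2.abs_eq[of "rep_l2 a" "rep_l2 b"] by (simp add: l2_rel_refl_iff square_integrable_rep)
qed (intro square_integrable_add square_integrable_rep)

lemma rep_l2_minus: "AE x in unit_measure. rep_l2 (a - b) x = rep_l2 a x - rep_l2 b x"
proof (rule AE_rep_l2_eq)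
  show "a - b = abs_l2 (\<lambda>x. rep_l2 a x - rep_l2 b x)"
    using minus_l2.abs_eq[of "rep_l2 a" "rep_l2 b"] by (simp add: l2_rel_refl_iff square_integrable_rep)
qed (intro square_integrable_diff square_integrable_rep)

lemma rep_l2_scaleR: "AE x in unit_measure. rep_l2 (c *\<^sub>R a) x = c * rep_l2 a x"
proof (rule AE_rep_l2_eq)
  show "c *\<^sub>R a = abs_l2 (\<lambda>x. c * rep_l2 a x)"
    using scaleR_l2.abs_eq[of "rep_l2 a" c] by (simp add: l2_rel_refl_iff square_integrable_rep)
qed (intro square_integrable_scale square_integrable_rep)

lemma integrable_rep_l2: "integrable unit_measure (rep_l2 z)"
  by (rule square_integrable_L1(1)[OF square_integrable_rep])

lemma square_integrable_bounded:
  assumes m: "f \<in> borel_measurable unit_measure" and b: "\<And>x. x \<in> {0<..<1} \<Longrightarrow> \<bar>f x\<bar> \<le> B"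
  shows "square_integrable f"
    and "(LINT x|unit_measure. (f x)\<^sup>2) \<le> B\<^sup>2"
proof -
  have B: "(f x)\<^sup>2 \<le> B\<^sup>2" if "x \<in> {0<..<1}" for x
    using power_mono[OF b[OF that], of 2] by simp
  have i: "integrable unit_measure (\<lambda>x. (f x)\<^sup>2)"
    by (rule Bochner_Integration.integrable_bound[of _ "\<lambda>_. B\<^sup>2"])
       (use m B in \<open>auto simp: integrable_restrict_space AE_unit_iff\<close>)
  then show "square_integrable f" using m by (simp add: square_integrable_def)
  have "(LINT x|unit_measure. (f x)\<^sup>2) \<le> (LINT x|unit_measure. B\<^sup>2)"
    by (intro integral_mono_AE i) (use B in \<open>auto simp: AE_unit_iff integrable_restrict_space\<close>)
  then show "(LINT x|unit_measure. (f x)\<^sup>2) \<le> B\<^sup>2"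
    by (simp add: measure_restrict_space)
qed

lemma square_integrable_continuous:
  assumes "continuous_on {0..1} f"
  shows "square_integrable f"
proof -
  obtain B where "\<forall>x\<in>{0..1}. \<bar>f x\<bar> \<le> B"
    using compact_imp_bounded[OF compact_continuous_image[OF assms]]
    by (auto simp: bounded_iff)
  moreover have "f \<in> borel_measurable unit_measure"
    by (intro continuous_imp_measurable_on_sets_lebesgue continuous_on_subset[OF assms]) auto
  ultimately show ?thesis by (intro square_integrable_bounded(1)) auto
qed

text \<open>Used for integration by parts and for integrating Volterra terms. Continuity of
  \<open>K\<close> on the whole plane supplies both joint Borel measurability and a bound on the
  unit square.\<close>

lemma Fubini_triangle_borel:
  fixes K :: "real \<Rightarrow> real \<Rightarrow> real"
  assumes K: "continuous_on UNIV (\<lambda>(s, y). K s y)"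
    and g: "g \<in> borel_measurable borel" "integrable lborel g"
    and x: "0 \<le> x" "x \<le> 1"
  shows "integral {0..x} (\<lambda>s. integral {0..s} (\<lambda>y. K s y * g y)) =
    integral {0..x} (\<lambda>y. integral {y..x} (\<lambda>s. K s y) * g y)"
proof -
  note g(1)[measurable]
  have "(\<lambda>p. K (fst p) (snd p)) \<in> borel_measurable borel"
    using borel_measurable_continuous_onI[OF K] by (simp add: case_prod_beta')
  then have Km [measurable]: "(\<lambda>p. K (fst p) (snd p)) \<in> borel_measurable (borel \<Otimes>\<^sub>M borel)"
    by (simp add: borel_prod)
  have Ky: "continuous_on A (\<lambda>s. K s y)" for y A
    using continuous_on_compose2[OF K, of A "\<lambda>s. (s, y)"] by (simp add: continuous_on_Pair)
  obtain B where B: "\<forall>p\<in>{0..1}\<times>{0..1}. \<bar>case p of (s, y) \<Rightarrow> K s y\<bar> \<le> B"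
    using compact_imp_bounded[OF compact_continuous_image[OF continuous_on_subset[OF K subset_UNIV]
        compact_Times[OF compact_Icc compact_Icc]]]
    unfolding bounded_iff by fastforce
  \<comment> \<open>After the cut-off to the triangle, both sides are iterated integrals of the same
    function over the full line. It is dominated by \<open>B * \<bar>g y\<bar>\<close> on the strip
    where \<open>s\<close> lies in \<open>[0, 1]\<close>, hence integrable on the product.\<close>
  define f where "f s y = (if 0 \<le> y \<and> y \<le> s \<and> s \<le> x then K s y * g y else 0)" for s y
  have fm: "(\<lambda>p. f (fst p) (snd p)) \<in> borel_measurable (borel \<Otimes>\<^sub>M borel)"
    unfolding f_def by measurable
  have fle: "\<bar>f s y\<bar> \<le> indicator {0..1} s * (B * \<bar>g y\<bar>)" for s y
  proof (cases "0 \<le> y \<and> y \<le> s \<and> s \<le> x")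
    case True
    then have "\<bar>K s y\<bar> \<le> B" using B x by fastforce
    then show ?thesis using True x by (simp add: f_def abs_mult mult_right_mono)
  next
    case False
    have "0 \<le> B" using B by fastforce
    moreover have "f s y = 0" using False by (auto simp: f_def)
    ultimately show ?thesis by simp
  qed
  then have fle': "norm (f s y) \<le> norm (indicator {0..1} s * (B * \<bar>g y\<bar>))" for s y
    using order_trans[OF fle abs_ge_self] by simp
  have fsm: "(\<lambda>y. f s y) \<in> borel_measurable borel" "(\<lambda>s. f s y) \<in> borel_measurable borel" for s y
    using measurable_compose[OF _ fm, of "\<lambda>y. (s, y)" borel] measurable_compose[OF _ fm, of "\<lambda>s. (s, y)" borel]
    by auto
  have fs: "integrable lborel (\<lambda>y. f s y)" for s
    by (rule Bochner_Integration.integrable_bound[of _ "\<lambda>y. indicator {0..1} s * (B * \<bar>g y\<bar>)"])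
       (use g fsm fle' in \<open>auto intro!: integrable_mult_right\<close>)
  have fy: "integrable lborel (\<lambda>s. f s y)" for y
    by (rule Bochner_Integration.integrable_bound[of _ "\<lambda>s. indicator {0..1} s * (B * \<bar>g y\<bar>)"])
       (use fsm fle' in \<open>auto intro!: integrable_mult_left\<close>)
  have "integrable (lborel \<Otimes>\<^sub>M lborel) (\<lambda>p. f (fst p) (snd p))"
  proof (rule lborel_pair.Fubini_integrable)
    show "(\<lambda>p. f (fst p) (snd p)) \<in> borel_measurable (lborel \<Otimes>\<^sub>M lborel)" using fm by simp
    show "AE s in lborel. integrable lborel (\<lambda>y. f (fst (s, y)) (snd (s, y)))" using fs by simp
    show "integrable lborel (\<lambda>s. LINT y|lborel. norm (f (fst (s, y)) (snd (s, y))))"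
    proof (rule Bochner_Integration.integrable_bound)
      show "integrable lborel (\<lambda>s::real. indicator {0..1} s * (LINT y|lborel. B * \<bar>g y\<bar>))"
        by (intro integrable_mult_left integrable_real_indicator) auto
      show "(\<lambda>s. LINT y|lborel. norm (f (fst (s, y)) (snd (s, y)))) \<in> borel_measurable lborel"
        using fm by (intro lborel.borel_measurable_lebesgue_integral) (simp add: case_prod_beta)
      have le: "(LINT y|lborel. \<bar>f s y\<bar>) \<le> indicator {0..1} s * (LINT y|lborel. B * \<bar>g y\<bar>)" for s
      proof -
        have "(LINT y|lborel. \<bar>f s y\<bar>) \<le> (LINT y|lborel. indicator {0..1} s * (B * \<bar>g y\<bar>))"
          using fle fs g(2) by (intro integral_mono) (auto intro!: integrable_mult_right)
        then show ?thesis by simp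
      qed
      have nn: "\<bar>LINT y|lborel. \<bar>f s y\<bar>\<bar> = (LINT y|lborel. \<bar>f s y\<bar>)" for s
        by (intro abs_of_nonneg integral_nonneg_AE) simp
      have "norm (LINT y|lborel. norm (f (fst (s, y)) (snd (s, y))))
          \<le> norm (indicator {0..1} s * (LINT y|lborel. B * \<bar>g y\<bar>))" for s
        using order_trans[OF le abs_ge_self, of s] by (simp only: real_norm_def fst_conv snd_conv nn)
      then show "AE s in lborel. norm (LINT y|lborel. norm (f (fst (s, y)) (snd (s, y))))
          \<le> norm (indicator {0..1} s * (LINT y|lborel. B * \<bar>g y\<bar>))"
        by (rule AE_I2)
    qed
  qed
  then have fp: "integrable (lborel \<Otimes>\<^sub>M lborel) (\<lambda>(s, y). f s y)"
    by (simp add: case_prod_beta')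
  then have "(LINT y|lborel. LINT s|lborel. f s y) = (LINT s|lborel. LINT y|lborel. f s y)"
    by (rule lborel_pair.Fubini_integral)
  moreover have y: "(LINT y|lborel. f s y) = indicator {0..x} s * integral {0..s} (\<lambda>y. K s y * g y)" for s
  proof (cases "s \<in> {0..x}")
    case True
    then have eq: "f s y = indicator {0..s} y *\<^sub>R (K s y * g y)" for y
      by (auto simp: f_def)
    have "set_integrable lborel {0..s} (\<lambda>y. K s y * g y)"
      using fs[of s] unfolding eq set_integrable_def .
    then show ?thesis
      using True set_borel_integral_eq_integral(2)[of "{0..s}" "\<lambda>y. K s y * g y"]
      by (simp add: eq set_lebesgue_integral_def)
  next
    case False
    then have "f s y = 0" for y by (auto simp: f_def)
    then show ?thesis using False by simp
  qed
  moreover have s: "(LINT s|lborel. f s y) = indicator {0..x} y * (integral {y..x} (\<lambda>s. K s y) * g y)" for y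
  proof (cases "y \<in> {0..x}")
    case True
    then have eq: "f s y = (indicator {y..x} s *\<^sub>R K s y) * g y" for s
      by (auto simp: f_def)
    have "set_integrable lborel {y..x} (\<lambda>s. K s y)"
      by (rule borel_integrable_atLeastAtMost') (rule Ky)
    then show ?thesis
      using True set_borel_integral_eq_integral(2)[of "{y..x}" "\<lambda>s. K s y"]
      by (simp add: eq set_lebesgue_integral_def)
  next
    case False
    then have "f s y = 0" for s by (auto simp: f_def)
    then show ?thesis using False by simp
  qed
  ultimately have "(LINT y|lborel. indicator {0..x} y *\<^sub>R (integral {y..x} (\<lambda>s. K s y) * g y)) =
      (LINT s|lborel. indicator {0..x} s *\<^sub>R integral {0..s} (\<lambda>y. K s y * g y))"
    by simp
  then have eq: "(LINT y:{0..x}|lborel. integral {y..x} (\<lambda>s. K s y) * g y) =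
      (LINT s:{0..x}|lborel. integral {0..s} (\<lambda>y. K s y * g y))"
    unfolding set_lebesgue_integral_def .
  have i1: "set_integrable lborel {0..x} (\<lambda>y. integral {y..x} (\<lambda>s. K s y) * g y)"
    using lborel_pair.integrable_snd[OF fp] by (simp add: s set_integrable_def)
  have i2: "set_integrable lborel {0..x} (\<lambda>s. integral {0..s} (\<lambda>y. K s y * g y))"
    using lborel_pair.integrable_fst[OF fp] by (simp add: y set_integrable_def)
  show ?thesis
    using eq by (simp only: set_borel_integral_eq_integral(2)[OF i1] set_borel_integral_eq_integral(2)[OF i2])
qed

lemma Fubini_triangle:
  fixes K :: "real \<Rightarrow> real \<Rightarrow> real"
  assumes K: "continuous_on UNIV (\<lambda>(s, y). K s y)" and x: "0 \<le> x" "x \<le> 1"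
  shows "integral {0..x} (\<lambda>s. integral {0..s} (\<lambda>y. K s y * rep_l2 z y)) =
    integral {0..x} (\<lambda>y. integral {y..x} (\<lambda>s. K s y) * rep_l2 z y)"
proof -
  obtain g where g: "g \<in> borel_measurable borel" "square_integrable g"
    and ae: "AE x in unit_measure. rep_l2 z x = g x" and g0: "\<And>x. x \<notin> {0<..<1} \<Longrightarrow> g x = 0"
    by (rule l2_borel_rep[of z]) blast
  have "integrable lborel g"
    using integral_unit_lborel(1)[OF g(1) g0] square_integrable_L1(1)[OF g(2)] by simp
  from Fubini_triangle_borel[OF K g(1) this x]
  have "integral {0..x} (\<lambda>s. integral {0..s} (\<lambda>y. K s y * g y)) =
    integral {0..x} (\<lambda>y. integral {y..x} (\<lambda>s. K s y) * g y)" .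
  moreover have "integral {0..s} (\<lambda>y. K s y * g y) = integral {0..s} (\<lambda>y. K s y * rep_l2 z y)"
    if "s \<in> {0..x}" for s
    by (rule AE_unit_integral_cong) (use ae x that in auto)
  moreover have "integral {0..x} (\<lambda>y. integral {y..x} (\<lambda>s. K s y) * g y) =
      integral {0..x} (\<lambda>y. integral {y..x} (\<lambda>s. K s y) * rep_l2 z y)"
    by (rule AE_unit_integral_cong) (use ae x in auto)
  moreover have "integral {0..x} (\<lambda>s. integral {0..s} (\<lambda>y. K s y * rep_l2 z y)) =
      integral {0..x} (\<lambda>s. integral {0..s} (\<lambda>y. K s y * g y))"
    by (rule Henstock_Kurzweil_Integration.integral_cong) (simp only: calculation(2))
  ultimately show ?thesis by simp
qed

section \<open>Volterra operators\<close>

lemma closed_triangle: "closed triangle"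
  unfolding triangle_def case_prod_beta
  by (intro closed_Collect_conj closed_Collect_le continuous_intros)

lemma continuous_on_triangle_bound:
  assumes "continuous_on triangle (\<lambda>(x, y). k x y :: real)"
  obtains B where "B \<ge> 0" "\<And>x y. 0 \<le> y \<Longrightarrow> y \<le> x \<Longrightarrow> x \<le> 1 \<Longrightarrow> \<bar>k x y\<bar> \<le> B"
proof -
  have "triangle \<subseteq> {0..1} \<times> {0..1}" by (auto simp: triangle_def)
  then have "bounded triangle" by (rule bounded_subset[rotated]) (intro bounded_Times bounded_closed_interval)
  then have "compact triangle" by (simp add: compact_eq_bounded_closed closed_triangle)
  then obtain B where B: "\<forall>p\<in>triangle. \<bar>case p of (x, y) \<Rightarrow> k x y\<bar> \<le> B"
    using compact_imp_bounded[OF compact_continuous_image[OF assms]] unfolding bounded_iff by auto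
  have "\<bar>k x y\<bar> \<le> B" if "0 \<le> y" "y \<le> x" "x \<le> 1" for x y
    using B that unfolding triangle_def by auto
  moreover have "B \<ge> 0" using calculation[of 0 0] by simp
  ultimately show ?thesis using that by blast
qed

lemma rep_l2_absolutely_integrable:
  assumes "0 \<le> x" "x \<le> 1"
  shows "rep_l2 z absolutely_integrable_on {0..x}"
  by (rule set_integrable_subset[OF absolutely_integrable_unit[OF integrable_rep_l2]])
     (use assms in auto)

lemma integral_abs_rep_l2_le:
  assumes "0 \<le> x" "x \<le> 1"
  shows "integral {0..x} (\<lambda>y. \<bar>rep_l2 z y\<bar>) \<le> norm z"
proof -
  have i: "(\<lambda>y. \<bar>rep_l2 z y\<bar>) integrable_on {0..x}" if "0 \<le> x" "x \<le> 1" for x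
    using rep_l2_absolutely_integrable[OF that] by (simp add: absolutely_integrable_on_def)
  have "integral {0..x} (\<lambda>y. \<bar>rep_l2 z y\<bar>) \<le> integral {0..1} (\<lambda>y. \<bar>rep_l2 z y\<bar>)"
    using assms by (intro integral_subset_le i) auto
  also have "\<dots> = (LINT x|unit_measure. \<bar>rep_l2 z x\<bar>)"
    by (rule integral_unit_eq[symmetric]) (intro integrable_abs integrable_rep_l2)
  also have "\<dots> \<le> norm z"
    using square_integrable_L1(2)[OF square_integrable_rep, of z]
      norm_abs_l2[OF square_integrable_rep, of z, symmetric] by simp
  finally show ?thesis .
qed

lemma triangle_kernel_integrable:
  assumes k: "continuous_on triangle (\<lambda>(x, y). k x y)" and x: "0 \<le> x" "x \<le> 1"
  shows "(\<lambda>y. k x y * rep_l2 z y) absolutely_integrable_on {0..x}"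
proof (rule absolutely_integrable_bounded_measurable_product_real)
  have "continuous_on {0..x} (\<lambda>y. (x, y))" by (intro continuous_intros)
  then have kx: "continuous_on {0..x} (k x)"
    using continuous_on_compose2[OF k, of "{0..x}" "\<lambda>y. (x, y)"] x by (simp add: triangle_def image_subset_iff)
  then show "k x \<in> borel_measurable (lebesgue_on {0..x})"
    by (intro continuous_imp_measurable_on_sets_lebesgue) auto
  show "bounded (k x ` {0..x})" by (intro compact_imp_bounded compact_continuous_image kx) auto
qed (use rep_l2_absolutely_integrable[OF x] in auto)

lemma triangle_kernel_bound:
  assumes k: "continuous_on triangle (\<lambda>(x, y). k x y)"
    and B: "B \<ge> 0" "\<And>x y. 0 \<le> y \<Longrightarrow> y \<le> x \<Longrightarrow> x \<le> 1 \<Longrightarrow> \<bar>k x y\<bar> \<le> B"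
    and x: "0 \<le> x" "x \<le> 1"
  shows "\<bar>integral {0..x} (\<lambda>y. k x y * rep_l2 z y)\<bar> \<le> B * norm z"
proof -
  have i: "(\<lambda>y. B * \<bar>rep_l2 z y\<bar>) integrable_on {0..x}"
    using rep_l2_absolutely_integrable[OF x] by (intro integrable_on_mult_right) (simp add: absolutely_integrable_on_def)
  have "norm (integral {0..x} (\<lambda>y. k x y * rep_l2 z y)) \<le> integral {0..x} (\<lambda>y. B * \<bar>rep_l2 z y\<bar>)"
    using triangle_kernel_integrable[OF k x] i B(2) x(2)
    by (intro integral_norm_bound_integral)
       (auto simp: absolutely_integrable_on_def abs_mult intro: mult_right_mono)
  also have "\<dots> \<le> B * norm z"
    using integral_abs_rep_l2_le[OF x, of z] B(1) by (simp add: mult_left_mono)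
  finally show ?thesis by simp
qed

text \<open>With a Borel representative, and with the kernel extended by zero from the closed set
  \<open>triangle\<close>, the function is a parameter integral of a jointly Borel integrand, hence
  Borel. On the unit interval it coincides with the given one.\<close>

lemma triangle_kernel_measurable:
  assumes k: "continuous_on triangle (\<lambda>(x, y). k x y)"
  shows "(\<lambda>x. integral {0..x} (\<lambda>y. k x y * rep_l2 z y)) \<in> borel_measurable unit_measure"
proof -
  obtain g where g [measurable]: "g \<in> borel_measurable borel"
    and ae: "AE x in unit_measure. rep_l2 z x = g x"
    by (rule l2_borel_rep[of z]) blast
  have "(\<lambda>p. indicator triangle p *\<^sub>R (case p of (x, y) \<Rightarrow> k x y)) \<in> borel_measurable borel"
    using closed_triangle by (intro borel_measurable_continuous_on_indicator k) auto
  then have km [measurable]: "(\<lambda>p. indicator triangle p *\<^sub>R (case p of (x, y) \<Rightarrow> k x y)) \<in> borel_measurable (borel \<Otimes>\<^sub>M borel)"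
    by (simp add: borel_prod)
  have "(\<lambda>p. (indicator triangle p *\<^sub>R (case p of (x, y) \<Rightarrow> k x y)) * g (snd p)) \<in> borel_measurable (borel \<Otimes>\<^sub>M borel)"
    by measurable
  then have "(\<lambda>x. LINT y|lborel. (indicator triangle (x, y) *\<^sub>R k x y) * g y) \<in> borel_measurable borel"
    by (intro lborel.borel_measurable_lebesgue_integral) (simp add: case_prod_beta')
  then have m: "(\<lambda>x. LINT y|lborel. (indicator triangle (x, y) *\<^sub>R k x y) * g y) \<in> borel_measurable unit_measure"
    by (intro measurable_restrict_space1 measurable_completion) simp
  have "integral {0..x} (\<lambda>y. k x y * rep_l2 z y) = (LINT y|lborel. (indicator triangle (x, y) *\<^sub>R k x y) * g y)"
    if "x \<in> {0<..<1}" for x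
  proof -
    have x: "0 \<le> x" "x \<le> 1" using that by auto
    have eq: "indicator {0..x} y *\<^sub>R (k x y * g y) = (indicator triangle (x, y) *\<^sub>R k x y) * g y" for y
      using x by (auto simp: triangle_def indicator_def)
    have hm: "(\<lambda>y. (indicator triangle (x, y) *\<^sub>R k x y) * g y) \<in> borel_measurable borel"
      using measurable_compose[OF measurable_Pair1' km, of x] by simp
    have "integral {0..x} (\<lambda>y. k x y * rep_l2 z y) = integral {0..x} (\<lambda>y. k x y * g y)"
      by (rule AE_unit_integral_cong) (use ae x in auto)
    also have "\<dots> = (LINT y:{0..x}|lebesgue. k x y * g y)"
    proof (rule set_lebesgue_integral_eq_integral(2)[symmetric])
      have "(\<lambda>y. k x y * rep_l2 z y) absolutely_integrable_on {0..x}"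
        by (rule triangle_kernel_integrable[OF k x])
      moreover have "AE y in lebesgue. indicator {0..x} y *\<^sub>R (k x y * rep_l2 z y) =
          indicator {0..x} y *\<^sub>R (k x y * g y)"
      proof -
        have "AE y in lborel. y \<noteq> 0" "AE y in lborel. y \<noteq> 1" by (simp_all add: AE_lborel_singleton)
        then show ?thesis
          unfolding AE_completion_iff using ae[unfolded AE_unit_iff]
          by eventually_elim (use x in \<open>auto simp: indicator_def\<close>)
      qed
      moreover have "set_borel_measurable lebesgue {0..x} (\<lambda>y. k x y * g y)"
        unfolding set_borel_measurable_def eq using hm by (intro measurable_completion) simp
      ultimately show "(\<lambda>y. k x y * g y) absolutely_integrable_on {0..x}"
        unfolding set_integrable_def set_borel_measurable_def
        by - (rule integrable_cong_AE_imp)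
    qed
    also have "\<dots> = (LINT y|lborel. (indicator triangle (x, y) *\<^sub>R k x y) * g y)"
      unfolding set_lebesgue_integral_def eq using hm by (intro integral_completion) simp
    finally show ?thesis .
  qed
  then show ?thesis
    using m by (subst measurable_cong) auto
qed

lemma volterra_integral_eq:
  assumes k: "continuous_on triangle (\<lambda>(x, y). k x y)" and x: "x \<in> {0<..<1}"
  shows "(LINT y:{0<..<x}|lebesgue. k x y * rep_l2 z y) = integral {0..x} (\<lambda>y. k x y * rep_l2 z y)"
proof -
  have "(\<lambda>y. k x y * rep_l2 z y) absolutely_integrable_on {0..x}"
    using x by (intro triangle_kernel_integrable[OF k]) auto
  then have "(\<lambda>y. k x y * rep_l2 z y) absolutely_integrable_on {0<..<x}"
    by (rule set_integrable_subset) auto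
  then have "(LINT y:{0<..<x}|lebesgue. k x y * rep_l2 z y) = integral {0<..<x} (\<lambda>y. k x y * rep_l2 z y)"
    by (rule set_lebesgue_integral_eq_integral)
  then show ?thesis by (simp add: integral_open_interval_real)
qed

text \<open>The output is bounded pointwise by \<open>B * norm z\<close>, since the L1 norm on an
  interval of length 1 is at most the L2 norm; for the same reason this sup bound also bounds the L2
  norm of the output.\<close>

lemma volterra_square_integrable:
  assumes k: "continuous_on triangle (\<lambda>(x, y). k x y)"
    and B: "B \<ge> 0" "\<And>x y. 0 \<le> y \<Longrightarrow> y \<le> x \<Longrightarrow> x \<le> 1 \<Longrightarrow> \<bar>k x y\<bar> \<le> B"
  shows "square_integrable (\<lambda>x. LINT y:{0<..<x}|lebesgue. k x y * rep_l2 z y)"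
    and "norm (volterra k z) \<le> B * norm z"
proof -
  let ?f = "\<lambda>x. LINT y:{0<..<x}|lebesgue. k x y * rep_l2 z y"
  have m: "?f \<in> borel_measurable unit_measure"
    using triangle_kernel_measurable[OF k, of z] volterra_integral_eq[OF k, of _ z]
    by (subst measurable_cong) auto
  have le: "\<bar>?f x\<bar> \<le> B * norm z" if "x \<in> {0<..<1}" for x
    using triangle_kernel_bound[OF k B, of x z] that volterra_integral_eq[OF k that, of z] by auto
  show sq: "square_integrable ?f"
    using m le by (rule square_integrable_bounded(1))
  have "(norm (volterra k z))\<^sup>2 \<le> (B * norm z)\<^sup>2"
    unfolding volterra_def norm_abs_l2[OF sq] using m le by (rule square_integrable_bounded(2))
  then show "norm (volterra k z) \<le> B * norm z"
    by (rule power2_le_imp_le) (use B in auto)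
qed

lemma rep_volterra:
  assumes k: "continuous_on triangle (\<lambda>(x, y). k x y)"
  shows "AE x in unit_measure. rep_l2 (volterra k z) x = integral {0..x} (\<lambda>y. k x y * rep_l2 z y)"
proof -
  obtain B where B: "B \<ge> 0" "\<And>x y. 0 \<le> y \<Longrightarrow> y \<le> x \<Longrightarrow> x \<le> 1 \<Longrightarrow> \<bar>k x y\<bar> \<le> B"
    using continuous_on_triangle_bound[OF k] by blast
  have "AE x in unit_measure. rep_l2 (volterra k z) x = (LINT y:{0<..<x}|lebesgue. k x y * rep_l2 z y)"
    unfolding volterra_def by (rule rep_abs_l2[OF volterra_square_integrable(1)[OF k B]])
  moreover have "AE x in unit_measure. x \<in> {0<..<1}" by (simp add: AE_unit_iff)
  ultimately show ?thesis
    by eventually_elim (simp add: volterra_integral_eq[OF k])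
qed

text \<open>Linearity passes through two null sets: one under the integral sign, where the
  representative of a sum differs from the sum of representatives, and one outside, for the
  resulting class.\<close>

lemma bounded_linear_volterra:
  assumes k: "continuous_on triangle (\<lambda>(x, y). k x y)"
  shows "bounded_linear (volterra k)"
proof -
  obtain B where B: "B \<ge> 0" "\<And>x y. 0 \<le> y \<Longrightarrow> y \<le> x \<Longrightarrow> x \<le> 1 \<Longrightarrow> \<bar>k x y\<bar> \<le> B"
    using continuous_on_triangle_bound[OF k] by blast
  have int: "(\<lambda>y. k x y * rep_l2 z y) integrable_on {0..x}" if "x \<in> {0<..<1}" for x z
    using triangle_kernel_integrable[OF k, of x z] that by (simp add: absolutely_integrable_on_def)
  have unit: "AE x in unit_measure. x \<in> {0<..<1}" by (simp add: AE_unit_iff)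
  show ?thesis
  proof (rule bounded_linear_intro)
    show "volterra k (a + b) = volterra k a + volterra k b" for a b
    proof (rule l2_eqI)
      show "AE x in unit_measure. rep_l2 (volterra k (a + b)) x = rep_l2 (volterra k a + volterra k b) x"
        using rep_volterra[OF k, of "a + b"] rep_volterra[OF k, of a] rep_volterra[OF k, of b]
          rep_l2_plus[of "volterra k a" "volterra k b"] unit
      proof eventually_elim
        case (elim x)
        have "integral {0..x} (\<lambda>y. k x y * rep_l2 (a + b) y) =
            integral {0..x} (\<lambda>y. k x y * rep_l2 a y + k x y * rep_l2 b y)"
        proof (rule AE_unit_integral_cong)
          show "AE y in unit_measure. k x y * rep_l2 (a + b) y = k x y * rep_l2 a y + k x y * rep_l2 b y"
            using rep_l2_plus[of a b] by eventually_elim (simp add: algebra_simps)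
        qed (use elim in simp)
        also have "\<dots> = integral {0..x} (\<lambda>y. k x y * rep_l2 a y) + integral {0..x} (\<lambda>y. k x y * rep_l2 b y)"
          using elim(5) by (intro Henstock_Kurzweil_Integration.integral_add int)
        finally show ?case using elim by simp
      qed
    qed
    show "volterra k (c *\<^sub>R a) = c *\<^sub>R volterra k a" for c a
    proof (rule l2_eqI)
      show "AE x in unit_measure. rep_l2 (volterra k (c *\<^sub>R a)) x = rep_l2 (c *\<^sub>R volterra k a) x"
        using rep_volterra[OF k, of "c *\<^sub>R a"] rep_volterra[OF k, of a]
          rep_l2_scaleR[of c "volterra k a"] unit
      proof eventually_elim
        case (elim x)
        have "integral {0..x} (\<lambda>y. k x y * rep_l2 (c *\<^sub>R a) y) =
            integral {0..x} (\<lambda>y. c * (k x y * rep_l2 a y))"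
        proof (rule AE_unit_integral_cong)
          show "AE y in unit_measure. k x y * rep_l2 (c *\<^sub>R a) y = c * (k x y * rep_l2 a y)"
            using rep_l2_scaleR[of c a] by eventually_elim simp
        qed (use elim in simp)
        then show ?case using elim by simp
      qed
    qed
    show "norm (volterra k z) \<le> norm z * B" for z
      using volterra_square_integrable(2)[OF k B, of z] by (simp add: mult.commute)
  qed
qed

section \<open>Weak derivatives and primitives\<close>

text \<open>Test functions are only required to be C1, so the squared positive part suffices to glue
  a bump smoothly to zero.\<close>

lemma has_real_derivative_max_0_square:
  "((\<lambda>x::real. (max 0 x)\<^sup>2) has_real_derivative 2 * max 0 x) (at x)"
proof -
  consider "x > 0" | "x < 0" | "x = 0" by linarith
  then show ?thesis
  proof cases
    case 1
    have "((\<lambda>x::real. x\<^sup>2) has_real_derivative 2 * max 0 x) (at x)"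
      using 1 by (auto intro!: derivative_eq_intros)
    then show ?thesis
      by (rule has_field_derivative_transform_within_open[where S = "{0<..}"]) (use 1 in auto)
  next
    case 2
    have "((\<lambda>x::real. 0) has_real_derivative 2 * max 0 x) (at x)"
      using 2 by (auto intro!: derivative_eq_intros)
    then show ?thesis
      by (rule has_field_derivative_transform_within_open[where S = "{..<0}"]) (use 2 in auto)
  next
    case 3
    have "((\<lambda>h::real. (max 0 h)\<^sup>2 / h) \<longlongrightarrow> 0) (at 0)"
    proof (rule Lim_null_comparison)
      show "\<forall>\<^sub>F h::real in at 0. norm ((max 0 h)\<^sup>2 / h) \<le> \<bar>h\<bar>"
        by (intro always_eventually) (auto simp: max_def power2_eq_square)
      show "((\<lambda>h::real. \<bar>h\<bar>) \<longlongrightarrow> 0) (at 0)"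
        by (intro tendsto_rabs_zero tendsto_ident_at)
    qed
    then show ?thesis using 3 by (simp add: has_field_derivative_iff)
  qed
qed

section \<open>Test functions and their density\<close>

lemma test_functionI:
  assumes "\<And>x. (\<phi> has_real_derivative D x) (at x)" "continuous_on UNIV D"
    and "0 < a" "b < 1" "\<And>x. x \<notin> {a..b} \<Longrightarrow> \<phi> x = 0"
  shows "test_function \<phi>"
proof -
  have "\<phi> C1_differentiable_on UNIV"
    unfolding C1_differentiable_on_def
    using assms(1,2) by (auto simp: has_real_derivative_iff_has_vector_derivative)
  moreover have "closure {x. \<phi> x \<noteq> 0} \<subseteq> {a..b}"
    using assms(5) by (intro closure_minimal) blast+
  ultimately show ?thesis using assms(3,4) by (force simp: test_function_def)
qed

lemma test_functionD:
  assumes "test_function \<phi>"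
  shows "(\<phi> has_real_derivative deriv \<phi> x) (at x)" and "continuous_on UNIV (deriv \<phi>)"
    and "continuous_on UNIV \<phi>"
    and "\<exists>a b. 0 < a \<and> a < b \<and> b < 1 \<and> (\<forall>x. x \<notin> {a..b} \<longrightarrow> \<phi> x = 0)"
proof -
  obtain D where D: "\<And>x. (\<phi> has_real_derivative D x) (at x)" "continuous_on UNIV D"
    using assms unfolding test_function_def C1_differentiable_on_def
    by (auto simp: has_real_derivative_iff_has_vector_derivative)
  have "deriv \<phi> = D" using D(1) by (auto intro: DERIV_imp_deriv)
  then show "(\<phi> has_real_derivative deriv \<phi> x) (at x)" "continuous_on UNIV (deriv \<phi>)"
    using D by auto
  show "continuous_on UNIV \<phi>" using D(1) DERIV_continuous_on by blast
  let ?K = "closure {x. \<phi> x \<noteq> 0}"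
  have K: "?K \<subseteq> {0<..<1}" using assms by (simp add: test_function_def)
  have sub: "{x. \<phi> x \<noteq> 0} \<subseteq> ?K" by (rule closure_subset)
  show "\<exists>a b. 0 < a \<and> a < b \<and> b < 1 \<and> (\<forall>x. x \<notin> {a..b} \<longrightarrow> \<phi> x = 0)"
  proof (cases "?K = {}")
    case True
    then show ?thesis using sub by (intro exI[of _ "1/3"] exI[of _ "2/3"]) auto
  next
    case False
    have "bounded ?K" by (rule bounded_subset[OF _ K]) simp
    then have "compact ?K" by (simp add: compact_eq_bounded_closed)
    then obtain p q where pq: "p \<in> ?K" "q \<in> ?K" "\<And>x. x \<in> ?K \<Longrightarrow> p \<le> x \<and> x \<le> q"
      using compact_attains_inf[of ?K] compact_attains_sup[of ?K] False by metis
    have "0 < p" "q < 1" "p \<le> q" using pq K by auto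
    \<comment> \<open>The right end is moved from \<open>q\<close> to the midpoint of
      \<open>q\<close> and 1, so that the strict inequality of the two ends follows from
      \<open>p \<le> q\<close> alone.\<close>
    moreover have "\<phi> x = 0" if "x \<notin> {p..(q + 1) / 2}" for x
      using pq(3)[of x] sub that \<open>q < 1\<close> by force
    ultimately show ?thesis by (intro exI[of _ p] exI[of _ "(q + 1) / 2"]) auto
  qed
qed

text \<open>A C1 approximation of the indicator of the interval from \<open>a\<close> to 1. The
  quotient tends to 1 wherever \<open>q\<close> stays away from 0; subtracting
  \<open>1 / Suc n\<close> inside the positive part pushes the support into a compact subset of the
  open unit interval.\<close>

definition bump :: "real \<Rightarrow> nat \<Rightarrow> real \<Rightarrow> real" where
  "bump a n x = (let q = (max 0 ((x - a) * (1 - x) - 1 / Suc n))\<^sup>2 in q / (q + 1 / Suc n))"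

lemma test_function_bump:
  assumes "0 \<le> a" "a < 1"
  shows "test_function (bump a n)"
proof -
  define r :: real where "r = 1 / Suc n"
  have r: "r > 0" by (simp add: r_def)
  define p where "p x = (x - a) * (1 - x) - r" for x
  define q where "q x = (max 0 (p x))\<^sup>2" for x
  define q' where "q' x = 2 * max 0 (p x) * (1 + a - 2 * x)" for x
  have b: "bump a n = (\<lambda>x. q x / (q x + r))" by (simp only: bump_def Let_def fun_eq_iff q_def p_def r_def simp_thms)
  have p: "(p has_real_derivative (1 + a - 2 * x)) (at x)" for x
    unfolding p_def by (auto intro!: derivative_eq_intros simp: algebra_simps)
  have q: "(q has_real_derivative q' x) (at x)" for x
    unfolding q_def q'_def by (rule DERIV_chain2[OF has_real_derivative_max_0_square p])
  have pos: "q x + r > 0" for x using r by (intro add_nonneg_pos) (auto simp: q_def)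
  show ?thesis
    unfolding b
  proof (rule test_functionI)
    show "((\<lambda>x. q x / (q x + r)) has_real_derivative (q' x * (q x + r) - q x * q' x) / (q x + r)\<^sup>2) (at x)" for x
      using pos[of x] by (auto intro!: derivative_eq_intros q simp: power2_eq_square)
    have "continuous_on UNIV q" using q DERIV_continuous_on by blast
    moreover have "continuous_on UNIV q'"
      unfolding q'_def p_def by (intro continuous_intros)
    ultimately show "continuous_on UNIV (\<lambda>x. (q' x * (q x + r) - q x * q' x) / (q x + r)\<^sup>2)"
      using pos by (intro continuous_intros) (auto simp: less_imp_neq[symmetric])
    show "0 < r" by (rule r)
    show "1 - r < 1" using r by simp
    show "q x / (q x + r) = 0" if "x \<notin> {r..1 - r}" for x
    proof -
      have "p x \<le> 0"
      proof (rule ccontr)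
        assume "\<not> p x \<le> 0"
        then have prod: "(x - a) * (1 - x) > r" by (simp add: p_def)
        then have "(x - a) * (1 - x) > 0" using r by linarith
        then have x: "a < x" "x < 1" using assms by (auto simp: zero_less_mult_iff)
        \<comment> \<open>Neither factor exceeds 1, so each one must exceed \<open>r\<close>; this
          keeps \<open>x\<close> at distance more than \<open>r\<close> from both 0 and 1.\<close>
        have "(x - a) * (1 - x) \<le> (x - a) * 1" "(x - a) * (1 - x) \<le> 1 * (1 - x)"
          using x assms by (auto intro!: mult_left_mono mult_right_mono)
        then show False using prod that assms by auto
      qed
      then show ?thesis by (simp add: q_def)
    qed
  qed
qed

lemma bump_bounds: "0 \<le> bump a n x" "bump a n x \<le> 1"
  by (auto simp: bump_def Let_def intro!: divide_nonneg_pos add_nonneg_pos divide_le_eq_1_pos[THEN iffD2])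

lemma bump_tendsto:
  assumes "0 \<le> a" "x \<in> {0<..<1}"
  shows "(\<lambda>n. bump a n x) \<longlonglongrightarrow> indicator {a<..<1} x"
proof (cases "x > a")
  case True
  define s where "s = (x - a) * (1 - x)"
  have s: "s > 0" using True assms by (simp add: s_def)
  have "(\<lambda>n. (max 0 (s - 1 / real (Suc n)))\<^sup>2) \<longlonglongrightarrow> (max 0 (s - 0))\<^sup>2"
    by (intro tendsto_intros LIMSEQ_Suc[OF lim_1_over_n])
  then have "(\<lambda>n. bump a n x) \<longlonglongrightarrow> (max 0 (s - 0))\<^sup>2 / ((max 0 (s - 0))\<^sup>2 + 0)"
    unfolding bump_def Let_def s_def[symmetric] using s
    by (intro tendsto_intros LIMSEQ_Suc[OF lim_1_over_n]) auto
  then show ?thesis using s True assms by simp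
next
  case False
  then have "(x - a) * (1 - x) \<le> 0" using assms by (intro mult_nonpos_nonneg) auto
  then have "max 0 ((x - a) * (1 - x) - 1 / real (Suc n)) = 0" for n
    by (intro max_absorb1) (smt (verit) divide_nonneg_nonneg of_nat_0_le_iff)
  then have "bump a n x = 0" for n by (simp add: bump_def Let_def del: of_nat_Suc)
  then show ?thesis using False by simp
qed

text \<open>Dominated convergence along the bumps makes the integral over every right tail vanish.
  The positive and the negative part of the function are then densities of measures that agree on
  all half-lines, so the measures, and with them the densities, coincide.\<close>

lemma AE_zero_if_orthogonal_to_test_functions:
  assumes f: "square_integrable f"
    and orth: "\<And>\<phi>. test_function \<phi> \<Longrightarrow> (LINT x|unit_measure. f x * \<phi> x) = 0"
  shows "AE x in unit_measure. f x = 0"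
proof -
  obtain g where g [measurable]: "g \<in> borel_measurable borel" and sg: "square_integrable g"
    and ae: "AE x in unit_measure. rep_l2 (abs_l2 f) x = g x" and g0: "\<And>x. x \<notin> {0<..<1} \<Longrightarrow> g x = 0"
    by (rule l2_borel_rep[of "abs_l2 f"]) blast
  have ae: "AE x in unit_measure. f x = g x"
    using rep_abs_l2[OF f] ae by eventually_elim simp
  have [measurable]: "f \<in> borel_measurable unit_measure" "g \<in> borel_measurable unit_measure"
    using f sg by (auto simp: square_integrable_def)
  have tail: "(LINT x|unit_measure. g x * indicator {a<..<1} x) = 0" if a: "0 \<le> a" "a < 1" for a
  proof -
    have bm: "bump a n \<in> borel_measurable unit_measure" for n
      by (intro continuous_imp_measurable_on_sets_lebesgue
          continuous_on_subset[OF test_functionD(3)[OF test_function_bump[OF a]]]) auto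
    have "(\<lambda>n. LINT x|unit_measure. g x * bump a n x) \<longlonglongrightarrow> (LINT x|unit_measure. g x * indicator {a<..<1} x)"
    proof (rule integral_dominated_convergence)
      show "integrable unit_measure (\<lambda>x. \<bar>g x\<bar>)" by (intro integrable_abs square_integrable_L1(1) sg)
      show "(\<lambda>x. g x * indicator {a<..<1} x) \<in> borel_measurable unit_measure"
        by (rule measurable_restrict_space1) (use g in \<open>intro measurable_completion, measurable\<close>)
      show "(\<lambda>x. g x * bump a n x) \<in> borel_measurable unit_measure" for n
        using bm by measurable
      show "AE x in unit_measure. (\<lambda>n. g x * bump a n x) \<longlonglongrightarrow> g x * indicator {a<..<1} x"
        unfolding AE_unit_iff by (intro AE_I2 impI tendsto_intros bump_tendsto a)
      show "AE x in unit_measure. norm (g x * bump a n x) \<le> \<bar>g x\<bar>" for n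
        using bump_bounds[of a n] by (intro AE_I2) (auto simp: abs_mult intro: mult_left_le)
    qed
    moreover have "(LINT x|unit_measure. g x * bump a n x) = 0" for n
    proof -
      have "(LINT x|unit_measure. g x * bump a n x) = (LINT x|unit_measure. f x * bump a n x)"
        using ae bm by (intro integral_cong_AE) (auto elim!: eventually_mono)
      then show ?thesis using orth[OF test_function_bump[OF a]] by simp
    qed
    ultimately show ?thesis by (simp add: LIMSEQ_const_iff)
  qed
  have gi: "integrable lborel g"
    using integral_unit_lborel(1)[OF g g0] square_integrable_L1(1)[OF sg] by simp
  \<comment> \<open>Half-lines with arbitrary real end are needed because they determine a measure
    on the whole line; as \<open>g\<close> vanishes off the unit interval, they reduce to the tails
    already treated.\<close>
  have tail': "(LINT x|lborel. g x * indicator {a<..} x) = 0" for a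
  proof (cases "a < 1")
    case True
    have "(LINT x|lborel. g x * indicator {a<..} x) = (LINT x|lborel. g x * indicator {max 0 a<..<1} x)"
      using g0 by (intro Bochner_Integration.integral_cong) (auto simp: indicator_def)
    also have "\<dots> = (LINT x|unit_measure. g x * indicator {max 0 a<..<1} x)"
      using g0 by (intro integral_unit_lborel(2)[symmetric]) auto
    finally show ?thesis using tail[of "max 0 a"] True by simp
  next
    case False
    then have "g x * indicator {a<..} x = 0" for x using g0[of x] by (auto simp: indicator_def)
    then show ?thesis by (intro integral_eq_zero_AE AE_I2)
  qed
  \<comment> \<open>\<open>ennreal\<close> sends negative reals to 0, so \<open>P\<close> and
    \<open>N\<close> are the positive and the negative part of \<open>g\<close>.\<close>
  define P where "P x = ennreal (g x)" for x
  define N where "N x = ennreal (- g x)" for x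
  have [measurable]: "P \<in> borel_measurable borel" "N \<in> borel_measurable borel"
    unfolding P_def N_def by measurable
  have "density lborel P = density lborel N"
  proof (rule measure_eqI_lessThan)
    fix a :: real
    let ?h = "\<lambda>x. g x * indicator {a<..} x"
    have hi: "integrable lborel ?h"
      by (rule Bochner_Integration.integrable_bound[OF gi]) (auto simp: indicator_def)
    have eP: "emeasure (density lborel P) {a<..} = (\<integral>\<^sup>+x. ennreal (?h x) \<partial>lborel)"
      by (subst emeasure_density) (auto intro!: nn_integral_cong simp: P_def indicator_def)
    have eN: "emeasure (density lborel N) {a<..} = (\<integral>\<^sup>+x. ennreal (- ?h x) \<partial>lborel)"
      by (subst emeasure_density) (auto intro!: nn_integral_cong simp: N_def indicator_def)
    have fin: "(\<integral>\<^sup>+x. ennreal (?h x) \<partial>lborel) \<noteq> \<infinity>" "(\<integral>\<^sup>+x. ennreal (- ?h x) \<partial>lborel) \<noteq> \<infinity>"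
      using hi unfolding real_integrable_def by auto
    then show "emeasure (density lborel P) {a<..} < \<infinity>"
      unfolding eP by (simp add: less_top)
    have "enn2real (\<integral>\<^sup>+x. ennreal (?h x) \<partial>lborel) = enn2real (\<integral>\<^sup>+x. ennreal (- ?h x) \<partial>lborel)"
      using tail'[of a] real_lebesgue_integral_def[OF hi] by simp
    moreover have "X = Y" if "enn2real X = enn2real Y" "X \<noteq> \<infinity>" "Y \<noteq> \<infinity>" for X Y
      using that by (cases X; cases Y) auto
    ultimately show "emeasure (density lborel P) {a<..} = emeasure (density lborel N) {a<..}"
      unfolding eP eN using fin by blast
  qed auto
  then have "AE x in lborel. P x = N x"
    by (intro sigma_finite_measure.density_unique[OF sigma_finite_lborel]) auto
  then have "AE x in unit_measure. g x = 0"
    unfolding AE_unit_iff 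
  proof eventually_elim
    case (elim x)
    show ?case
    proof (cases "g x \<ge> 0")
      case True
      then have "ennreal (- g x) = 0" by (simp add: ennreal_neg)
      with elim True show ?thesis by (simp add: P_def N_def)
    next
      case False
      then have "ennreal (g x) = 0" by (simp add: ennreal_neg)
      with elim False show ?thesis by (simp add: P_def N_def)
    qed
  qed
  with ae show ?thesis by eventually_elim simp
qed

section \<open>Orthogonality to derivatives of test functions\<close>

lemma test_function_diff_scale:
  assumes "test_function \<phi>" "test_function \<psi>"
  shows "test_function (\<lambda>x. \<phi> x - c * \<psi> x)"
proof -
  obtain a b where ab: "0 < a" "b < 1" "\<And>x. x \<notin> {a..b} \<Longrightarrow> \<phi> x = 0"
    using test_functionD(4)[OF assms(1)] by blast
  obtain a' b' where ab': "0 < a'" "b' < 1" "\<And>x. x \<notin> {a'..b'} \<Longrightarrow> \<psi> x = 0"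
    using test_functionD(4)[OF assms(2)] by blast
  show ?thesis
  proof (rule test_functionI)
    show "((\<lambda>x. \<phi> x - c * \<psi> x) has_real_derivative deriv \<phi> x - c * deriv \<psi> x) (at x)" for x
      by (auto intro!: derivative_eq_intros test_functionD(1) assms)
    show "continuous_on UNIV (\<lambda>x. deriv \<phi> x - c * deriv \<psi> x)"
      by (intro continuous_intros test_functionD(2) assms)
    show "0 < min a a'" "max b b' < 1" using ab ab' by auto
    show "\<phi> x - c * \<psi> x = 0" if "x \<notin> {min a a'..max b b'}" for x
    proof -
      have "x \<notin> {a..b}" "x \<notin> {a'..b'}" using that by auto
      then show ?thesis using ab(3) ab'(3) by simp
    qed
  qed
qed

lemma test_function_integrable:
  assumes "test_function \<phi>" "square_integrable f"
  shows "integrable unit_measure (\<lambda>x. f x * \<phi> x)" "integrable unit_measure (\<lambda>x. f x * deriv \<phi> x)"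
  by (intro square_integrable_mult assms square_integrable_continuous
      continuous_on_subset[OF test_functionD(2)[OF assms(1)]]
      continuous_on_subset[OF test_functionD(3)[OF assms(1)]] subset_UNIV)+

text \<open>The primitive vanishes to the left of the support in any case; to the right of it the
  zero mean is what makes it vanish.\<close>

lemma test_function_primitive:
  assumes h: "test_function h" and h0: "(LINT x|unit_measure. h x) = 0"
  obtains \<phi> where "test_function \<phi>" "deriv \<phi> = h"
proof -
  obtain a b where ab: "0 < a" "a < b" "b < 1" "\<And>x. x \<notin> {a..b} \<Longrightarrow> h x = 0"
    using test_functionD(4)[OF h] by blast
  have c: "continuous_on A h" for A by (rule continuous_on_subset[OF test_functionD(3)[OF h]]) auto
  have i: "h integrable_on {x..y}" for x y by (intro integrable_continuous_interval c)
  have h01: "integral {0..1} h = 0"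
    using h0 by (subst (asm) integral_unit_eq) (auto intro: square_integrable_L1(1) square_integrable_continuous c)
  define \<phi> where "\<phi> x = integral {0..x} h" for x
  have left: "\<phi> x = 0" if "x < a" for x
  proof -
    have "\<phi> x = integral {0..x} (\<lambda>_. 0)"
      unfolding \<phi>_def by (rule Henstock_Kurzweil_Integration.integral_cong) (use ab that in auto)
    then show ?thesis by simp
  qed
  have right: "\<phi> x = 0" if x: "x > b" for x
  proof -
    \<comment> \<open>Both \<open>x\<close> and 1 exceed \<open>b\<close>, and nothing is added
      between either of them and \<open>max x 1\<close>. So the integrals up to \<open>x\<close> and
      up to 1 agree, whichever is larger.\<close>
    have "integral {y..max x 1} h = 0" if "y > b" for y
    proof -
      have "integral {y..max x 1} h = integral {y..max x 1} (\<lambda>_. 0)"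
        by (rule Henstock_Kurzweil_Integration.integral_cong) (use ab that in auto)
      then show ?thesis by simp
    qed
    then have "integral {0..y} h = integral {0..max x 1} h" if "y > b" "y \<le> max x 1" for y
      using that ab Henstock_Kurzweil_Integration.integral_combine[of 0 y "max x 1" h] i by simp
    from this[of x] this[of 1] have "integral {0..x} h = integral {0..1} h" using x ab by simp
    then show ?thesis using h01 by (simp add: \<phi>_def)
  qed
  have d: "(\<phi> has_real_derivative h x) (at x)" for x
  proof -
    consider "x < a" | "x > b" | "0 < x" "x < 1" using ab by linarith
    then show ?thesis
    proof cases
      case 1
      have "((\<lambda>_. 0) has_real_derivative h x) (at x)" using 1 ab(4)[of x] by simp
      then show ?thesis
        by (rule has_field_derivative_transform_within_open[where S = "{..<a}"]) (use 1 left in auto)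
    next
      case 2
      have "((\<lambda>_. 0) has_real_derivative h x) (at x)" using 2 ab(4)[of x] by simp
      then show ?thesis
        by (rule has_field_derivative_transform_within_open[where S = "{b<..}"]) (use 2 right in auto)
    next
      case 3
      have "(\<phi> has_real_derivative h x) (at x within {0..1})"
        unfolding \<phi>_def using 3 by (intro integral_has_real_derivative c) auto
      then show ?thesis using 3 by (simp add: at_within_Icc_at)
    qed
  qed
  have "test_function \<phi>"
    by (rule test_functionI[OF d c ab(1,3)]) (use left right in force)
  moreover have "deriv \<phi> = h" using d by (auto intro: DERIV_imp_deriv)
  ultimately show ?thesis by (rule that)
qed

text \<open>Derivatives of test functions are exactly the test functions of mean zero. Any
  \<open>\<phi>\<close> becomes one after subtracting a multiple of a fixed \<open>\<psi>\<close> of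
  nonzero mean, and \<open>c\<close> is the constant for which \<open>f - c\<close> is orthogonal to
  that \<open>\<psi>\<close>.\<close>

lemma du_Bois_Reymond:
  assumes f: "square_integrable f"
    and orth: "\<And>\<phi>. test_function \<phi> \<Longrightarrow> (LINT x|unit_measure. f x * deriv \<phi> x) = 0"
  shows "\<exists>c. AE x in unit_measure. f x = c"
proof -
  have one: "square_integrable (\<lambda>_. c)" for c by (rule square_integrable_continuous) auto
  \<comment> \<open>If all test functions had mean zero, the constant 1 would be orthogonal to each
    of them and hence vanish almost everywhere.\<close>
  have "\<exists>\<psi>. test_function \<psi> \<and> (LINT x|unit_measure. \<psi> x) \<noteq> 0"
  proof (rule ccontr)
    assume "\<not> ?thesis"
    then have "AE x in unit_measure. (1::real) = 0"
      by (intro AE_zero_if_orthogonal_to_test_functions one) auto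
    then have "(LINT x|unit_measure. 1 :: real) = (LINT x|unit_measure. 0)"
      by (intro integral_cong_AE) auto
    then show False by (simp add: measure_restrict_space)
  qed
  then obtain \<psi> where \<psi>: "test_function \<psi>" "(LINT x|unit_measure. \<psi> x) \<noteq> 0" by blast
  define I where "I = (LINT x|unit_measure. \<psi> x)"
  define c where "c = (LINT x|unit_measure. f x * \<psi> x) / I"
  have "AE x in unit_measure. f x - c = 0"
  proof (rule AE_zero_if_orthogonal_to_test_functions)
    show "square_integrable (\<lambda>x. f x - c)" by (intro square_integrable_diff f one)
    fix \<phi> assume \<phi>: "test_function \<phi>"
    define J where "J = (LINT x|unit_measure. \<phi> x)"
    have i: "integrable unit_measure \<phi>" "integrable unit_measure \<psi>"
      using test_function_integrable(1)[OF \<phi> one[of 1]] test_function_integrable(1)[OF \<psi>(1) one[of 1]] by simp_all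
    let ?h = "\<lambda>x. \<phi> x - J / I * \<psi> x"
    have h: "test_function ?h" by (intro test_function_diff_scale \<phi> \<psi>)
    have "(LINT x|unit_measure. ?h x) = 0"
      using i \<psi>(2) by (simp add: I_def J_def)
    then obtain \<eta> where \<eta>: "test_function \<eta>" "deriv \<eta> = ?h" using test_function_primitive[OF h] by blast
    have "0 = (LINT x|unit_measure. f x * \<phi> x - J / I * (f x * \<psi> x))"
      using orth[OF \<eta>(1)] \<eta>(2) by (simp add: algebra_simps)
    also have "\<dots> = (LINT x|unit_measure. f x * \<phi> x) - J / I * (LINT x|unit_measure. f x * \<psi> x)"
      using test_function_integrable(1)[OF \<phi> f] test_function_integrable(1)[OF \<psi>(1) f] by simp
    finally have "(LINT x|unit_measure. f x * \<phi> x) = c * J" by (simp add: c_def)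
    moreover have "(LINT x|unit_measure. (f x - c) * \<phi> x) = (LINT x|unit_measure. f x * \<phi> x) - c * J"
      using test_function_integrable(1)[OF \<phi> f] i by (simp add: left_diff_distrib J_def)
    ultimately show "(LINT x|unit_measure. (f x - c) * \<phi> x) = 0" by simp
  qed
  then show ?thesis by (auto intro!: exI[of _ c])
qed

lemma continuous_primitive:
  "continuous_on {0..1} (\<lambda>x. integral {0..x} (rep_l2 z))"
  using rep_l2_absolutely_integrable[of 1 z]
  by (intro indefinite_integral_continuous_1) (auto simp: absolutely_integrable_on_def)

text \<open>The primitive need not be classically differentiable, so the parts formula comes from
  exchanging the integrations: the inner integral of \<open>deriv \<phi>\<close> from
  \<open>y\<close> to 1 is \<open>- \<phi> y\<close>.\<close>

lemma primitive_by_parts: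
  assumes "test_function \<phi>"
  shows "(LINT x|unit_measure. integral {0..x} (rep_l2 w) * deriv \<phi> x) =
    - (LINT x|unit_measure. rep_l2 w x * \<phi> x)"
proof -
  have \<phi>1: "\<phi> 1 = 0" using test_functionD(4)[OF assms] by force
  have ftc: "integral {y..1} (deriv \<phi>) = - \<phi> y" if "y \<le> 1" for y
  proof -
    have "(deriv \<phi> has_integral (\<phi> 1 - \<phi> y)) {y..1}"
      using test_functionD(1)[OF assms]
      by (intro fundamental_theorem_of_calculus[OF that])
         (auto intro: has_field_derivative_at_within simp: has_real_derivative_iff_has_vector_derivative[symmetric])
    then show ?thesis using \<phi>1 by (simp add: integral_unique)
  qed
  have "(LINT x|unit_measure. integral {0..x} (rep_l2 w) * deriv \<phi> x) =
      integral {0..1} (\<lambda>x. integral {0..x} (rep_l2 w) * deriv \<phi> x)"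
    by (intro integral_unit_eq test_function_integrable assms square_integrable_continuous continuous_primitive)
  also have "\<dots> = integral {0..1} (\<lambda>x. integral {0..x} (\<lambda>y. deriv \<phi> x * rep_l2 w y))"
    by (simp add: mult.commute)
  also have "\<dots> = integral {0..1} (\<lambda>y. integral {y..1} (\<lambda>s. deriv \<phi> s) * rep_l2 w y)"
    by (intro Fubini_triangle)
       (auto simp: case_prod_beta intro!: continuous_on_compose2[OF test_functionD(2)[OF assms]] continuous_intros)
  also have "\<dots> = integral {0..1} (\<lambda>y. - (rep_l2 w y * \<phi> y))"
    by (rule Henstock_Kurzweil_Integration.integral_cong) (simp add: ftc)
  also have "\<dots> = - (LINT x|unit_measure. rep_l2 w x * \<phi> x)"
    by (subst integral_unit_eq) (auto intro: test_function_integrable assms square_integrable_rep)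
  finally show ?thesis .
qed

section \<open>The Neumann resolvent\<close>

text \<open>Forwards, \<open>z\<close> minus the primitive of \<open>w\<close> is orthogonal to all
  derivatives of test functions and so constant. Backwards, constants integrate to zero against such
  derivatives. The right-hand side is continuous, which makes boundary values accessible.\<close>

lemma weak_derivative_iff_primitive:
  "weak_derivative z w \<longleftrightarrow>
     (\<exists>c. AE x in unit_measure. rep_l2 z x = c + integral {0..x} (rep_l2 w))"
proof -
  let ?P = "\<lambda>x. integral {0..x} (rep_l2 w)"
  have P: "square_integrable ?P" by (rule square_integrable_continuous[OF continuous_primitive])
  have one: "square_integrable (\<lambda>_. c)" for c by (rule square_integrable_continuous) auto
  have const: "(LINT x|unit_measure. c * deriv \<phi> x) = 0" if "test_function \<phi>" for \<phi> c
  proof -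
    have "(deriv \<phi> has_integral (\<phi> 1 - \<phi> 0)) {0..1}"
      using test_functionD(1)[OF that]
      by (intro fundamental_theorem_of_calculus)
         (auto intro: has_field_derivative_at_within simp: has_real_derivative_iff_has_vector_derivative[symmetric])
    moreover have "\<phi> 1 = 0" "\<phi> 0 = 0" using test_functionD(4)[OF that] by force+
    ultimately have "integral {0..1} (deriv \<phi>) = 0" by (simp add: integral_unique)
    then show ?thesis
      using integral_unit_eq[OF test_function_integrable(2)[OF that one[of c]]] by simp
  qed
  show ?thesis
  proof
    assume w: "weak_derivative z w"
    have "\<exists>c. AE x in unit_measure. rep_l2 z x - ?P x = c"
    proof (rule du_Bois_Reymond)
      show "square_integrable (\<lambda>x. rep_l2 z x - ?P x)"
        by (intro square_integrable_diff square_integrable_rep P)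
      fix \<phi> assume \<phi>: "test_function \<phi>"
      have "(LINT x|unit_measure. (rep_l2 z x - ?P x) * deriv \<phi> x) =
          (LINT x|unit_measure. rep_l2 z x * deriv \<phi> x) - (LINT x|unit_measure. ?P x * deriv \<phi> x)"
        unfolding left_diff_distrib
        by (intro Bochner_Integration.integral_diff test_function_integrable \<phi> P square_integrable_rep)
      then show "(LINT x|unit_measure. (rep_l2 z x - ?P x) * deriv \<phi> x) = 0"
        using w \<phi> primitive_by_parts[OF \<phi>, of w] by (simp add: weak_derivative_def)
    qed
    then show "\<exists>c. AE x in unit_measure. rep_l2 z x = c + ?P x"
      by (auto elim!: eventually_mono intro!: exI simp: algebra_simps)
  next
    assume "\<exists>c. AE x in unit_measure. rep_l2 z x = c + ?P x"
    then obtain c where c: "AE x in unit_measure. rep_l2 z x = c + ?P x" by blast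
    show "weak_derivative z w"
      unfolding weak_derivative_def
    proof (intro allI impI)
      fix \<phi> assume \<phi>: "test_function \<phi>"
      note int = test_function_integrable(2)[OF \<phi>]
      have "(LINT x|unit_measure. rep_l2 z x * deriv \<phi> x) =
          (LINT x|unit_measure. c * deriv \<phi> x + ?P x * deriv \<phi> x)"
        using c int[OF square_integrable_rep, of z] int[OF one, of c] int[OF P]
        by (intro integral_cong_AE)
           (auto elim!: eventually_mono simp: algebra_simps intro!: borel_measurable_integrable[OF Bochner_Integration.integrable_add])
      also have "\<dots> = - (LINT x|unit_measure. rep_l2 w x * \<phi> x)"
        using int[OF one, of c] int[OF P] const[OF \<phi>] primitive_by_parts[OF \<phi>, of w]
        by (subst Bochner_Integration.integral_add) auto
      finally show "(LINT x|unit_measure. rep_l2 z x * deriv \<phi> x) = - (LINT x|unit_measure. rep_l2 w x * \<phi> x)" .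
    qed
  qed
qed

text \<open>Two weak derivatives have equal integrals against every test function, so their
  difference is zero; this gives the definite description its meaning.\<close>

lemma wderiv_eq:
  assumes "weak_derivative z w"
  shows "wderiv z = w"
  unfolding wderiv_def
proof (rule the_equality[of "weak_derivative z", OF assms])
  fix v assume v: "weak_derivative z v"
  have "AE x in unit_measure. rep_l2 v x - rep_l2 w x = 0"
  proof (rule AE_zero_if_orthogonal_to_test_functions)
    show "square_integrable (\<lambda>x. rep_l2 v x - rep_l2 w x)"
      by (intro square_integrable_diff square_integrable_rep)
    fix \<phi> assume \<phi>: "test_function \<phi>"
    have "(LINT x|unit_measure. (rep_l2 v x - rep_l2 w x) * \<phi> x) =
        (LINT x|unit_measure. rep_l2 v x * \<phi> x) - (LINT x|unit_measure. rep_l2 w x * \<phi> x)"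
      unfolding left_diff_distrib
      by (intro Bochner_Integration.integral_diff test_function_integrable \<phi> square_integrable_rep)
    also have "\<dots> = 0" using assms v \<phi> by (simp add: weak_derivative_def)
    finally show "(LINT x|unit_measure. (rep_l2 v x - rep_l2 w x) * \<phi> x) = 0" .
  qed
  then show "v = w" by (intro l2_eqI) simp
qed

text \<open>Makes boundary values independent of the continuous representative: the set of agreement
  is closed and of full measure, so it contains the open interval, and then the end points by
  continuity.\<close>

lemma continuous_AE_unit_eq:
  fixes f g :: "real \<Rightarrow> real"
  assumes "continuous_on {0..1} f" "continuous_on {0..1} g"
    and ae: "AE x in unit_measure. f x = g x" and x: "x \<in> {0..1}"
  shows "f x = g x"
proof -
  have c: "continuous_on {0..1} (\<lambda>x. f x - g x)" by (intro continuous_intros assms)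
  have "f x - g x = 0"
  proof (rule continuous_constant_on_closure[of "{0<..<1}" "\<lambda>x. f x - g x"])
    show "continuous_on (closure {0<..<1}) (\<lambda>x. f x - g x)" using c by simp
    show "x \<in> closure {0<..<1}" using x by simp
    fix y :: real assume y: "y \<in> {0<..<1}"
    have "y \<in> {x \<in> {0..1}. f x - g x = 0}"
    proof (rule mem_closed_if_AE_lebesgue_open[OF _ _ _ y])
      show "closed {x \<in> {0..1}. f x - g x = 0}"
        by (intro continuous_closed_preimage_constant c) auto
      show "AE x\<in>{0<..<1} in lebesgue. x \<in> {x \<in> {0..1}. f x - g x = 0}"
        using ae unfolding AE_unit_iff AE_completion_iff by eventually_elim auto
    qed auto
    then show "f y - g y = 0" by simp
  qed
  then show ?thesis by simp
qed

text \<open>The condition at 0 removes the constant of integration of \<open>wderiv z\<close>; after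
  that, the condition at 1 says that the Laplacian has mean zero.\<close>

lemma neumann_domainE:
  assumes z: "z \<in> neumann_domain"
  obtains c where "AE x in unit_measure. rep_l2 z x = c + integral {0..x} (rep_l2 (wderiv z))"
    and "AE x in unit_measure. rep_l2 (wderiv z) x = integral {0..x} (rep_l2 (neumann_laplacian z))"
    and "integral {0..1} (rep_l2 (neumann_laplacian z)) = 0"
proof -
  let ?P = "\<lambda>x. integral {0..x} (rep_l2 (neumann_laplacian z))"
  obtain w where w: "weak_derivative z w" using z by (auto simp: neumann_domain_def H2_def H1_def)
  obtain h where h: "weak_derivative (wderiv z) h" using z by (auto simp: neumann_domain_def H2_def H1_def)
  obtain c where c: "AE x in unit_measure. rep_l2 z x = c + integral {0..x} (rep_l2 (wderiv z))"
    using w wderiv_eq[OF w] by (auto simp: weak_derivative_iff_primitive)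
  have "neumann_laplacian z = h" using wderiv_eq[OF h] by (simp add: neumann_laplacian_def)
  then obtain d where d: "AE x in unit_measure. rep_l2 (wderiv z) x = d + ?P x"
    using h by (auto simp: weak_derivative_iff_primitive)
  have bv: "d + ?P a = 0" if a: "a \<in> {0..1}" and b: "has_boundary_value (wderiv z) a 0" for a
  proof -
    obtain \<phi> where \<phi>: "continuous_on {0..1} \<phi>" "AE x in unit_measure. rep_l2 (wderiv z) x = \<phi> x" "\<phi> a = 0"
      using b by (auto simp: has_boundary_value_def)
    have "d + ?P a = \<phi> a"
    proof (rule continuous_AE_unit_eq[OF _ \<phi>(1) _ a])
      show "continuous_on {0..1} (\<lambda>x. d + ?P x)"
        by (intro continuous_intros continuous_primitive)
      show "AE x in unit_measure. d + ?P x = \<phi> x"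
        using d \<phi>(2) by eventually_elim simp
    qed
    with \<phi>(3) show ?thesis by simp
  qed
  have "d = 0" using bv[of 0] z by (simp add: neumann_domain_def)
  moreover have "d + ?P 1 = 0" using bv[of 1] z by (simp add: neumann_domain_def)
  ultimately show ?thesis using that[OF c] d by simp
qed

lemma neumann_domainI:
  assumes z: "AE x in unit_measure. rep_l2 z x = c + integral {0..x} (rep_l2 w)"
    and w: "AE x in unit_measure. rep_l2 w x = integral {0..x} (rep_l2 h)"
    and h: "integral {0..1} (rep_l2 h) = 0"
  shows "z \<in> neumann_domain" and "neumann_laplacian z = h"
proof -
  have zw: "weak_derivative z w" using z by (auto simp: weak_derivative_iff_primitive)
  have "\<exists>d. AE x in unit_measure. rep_l2 w x = d + integral {0..x} (rep_l2 h)"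
    by (rule exI[of _ 0]) (use w in simp)
  then have wh: "weak_derivative w h" by (simp add: weak_derivative_iff_primitive)
  have "has_boundary_value w a 0" if "a = 0 \<or> a = 1" for a
    unfolding has_boundary_value_def
    by (rule exI[of _ "\<lambda>x. integral {0..x} (rep_l2 h)"]) (use that w h continuous_primitive in auto)
  then show "z \<in> neumann_domain"
    using zw wh by (auto simp: neumann_domain_def H2_def H1_def wderiv_eq[OF zw])
  show "neumann_laplacian z = h"
    by (simp add: neumann_laplacian_def wderiv_eq[OF zw] wderiv_eq[OF wh])
qed

lemma integral_rep_l2_minus:
  assumes "0 \<le> x" "x \<le> 1"
  shows "integral {0..x} (rep_l2 (a - b)) = integral {0..x} (rep_l2 a) - integral {0..x} (rep_l2 b)"
proof -
  have i: "rep_l2 z integrable_on {0..x}" for z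
    using rep_l2_absolutely_integrable[OF assms] by (simp add: absolutely_integrable_on_def)
  have "integral {0..x} (rep_l2 (a - b)) = integral {0..x} (\<lambda>y. rep_l2 a y - rep_l2 b y)"
    by (rule AE_unit_integral_cong[OF rep_l2_minus assms(2)])
  also have "\<dots> = integral {0..x} (rep_l2 a) - integral {0..x} (rep_l2 b)"
    by (intro Henstock_Kurzweil_Integration.integral_diff i)
  finally show ?thesis .
qed

lemma integral_rep_l2_scaleR:
  assumes "x \<le> 1"
  shows "integral {0..x} (rep_l2 (c *\<^sub>R a)) = c * integral {0..x} (rep_l2 a)"
  using AE_unit_integral_cong[OF rep_l2_scaleR assms, of c a] by simp

lemma integral_rep_abs_l2:
  assumes "square_integrable f" "x \<le> 1"
  shows "integral {0..x} (rep_l2 (abs_l2 f)) = integral {0..x} f"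
  by (rule AE_unit_integral_cong[OF rep_abs_l2[OF assms(1)] assms(2)])

lemma integral_rep_volterra:
  assumes K: "continuous_on UNIV (\<lambda>(x, y). K x y)" and x: "0 \<le> x" "x \<le> 1"
  shows "integral {0..x} (rep_l2 (volterra K g)) = integral {0..x} (\<lambda>y. integral {y..x} (\<lambda>s. K s y) * rep_l2 g y)"
  unfolding Fubini_triangle[OF K x, symmetric]
  by (rule AE_unit_integral_cong[OF rep_volterra[OF continuous_on_subset[OF K subset_UNIV]] x(2)])

text \<open>The solution \<open>C\<close> of \<open>z'' = \<gamma> z\<close> with \<open>z' 0 = 0\<close> has \<open>z' 1 = \<gamma> Sn 1\<close>, so the last two assumptions
  say that \<open>\<gamma>\<close> is not an eigenvalue of the Neumann Laplacian.\<close>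

locale fundamental_pair =
  fixes \<gamma> :: real and C Sn :: "real \<Rightarrow> real"
  assumes C: "\<And>x. (C has_real_derivative \<gamma> * Sn x) (at x)"
    and Sn: "\<And>x. (Sn has_real_derivative C x) (at x)"
    and C0: "C 0 = 1" and Sn0: "Sn 0 = 0"
    and \<gamma>: "\<gamma> \<noteq> 0" and Sn1: "Sn 1 \<noteq> 0"
begin

text \<open>The Wronskian of the two fundamental solutions, which is constant along the
  equation.\<close>

lemma pythagoras: "(C x)\<^sup>2 - \<gamma> * (Sn x)\<^sup>2 = 1"
proof -
  have "((\<lambda>x. (C x)\<^sup>2 - \<gamma> * (Sn x)\<^sup>2) has_real_derivative 0) (at x)" for x
    by (auto intro!: derivative_eq_intros C Sn)
  then have "(C x)\<^sup>2 - \<gamma> * (Sn x)\<^sup>2 = (C 0)\<^sup>2 - \<gamma> * (Sn 0)\<^sup>2"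
    by (intro DERIV_isconst_all) auto
  then show ?thesis by (simp add: C0 Sn0)
qed

lemma continuous_C: "continuous_on A C" and continuous_Sn: "continuous_on A Sn"
  using C Sn by (meson DERIV_continuous_on has_field_derivative_at_within)+

lemma continuous_kernels:
  "continuous_on UNIV (\<lambda>(x, y). Sn (x - y))" "continuous_on UNIV (\<lambda>(x, y). C (x - y))"
  unfolding case_prod_beta
  by (auto intro!: continuous_on_compose2[OF continuous_C[of UNIV]] continuous_on_compose2[OF continuous_Sn[of UNIV]] continuous_intros)

lemma shift_derivative:
  "((\<lambda>s. C (s - a)) has_real_derivative \<gamma> * Sn (x - a)) (at x within A)"
  "((\<lambda>s. Sn (s - a)) has_real_derivative C (x - a)) (at x within A)"
proof -
  have "((\<lambda>s. s - a) has_real_derivative 1) (at x within A)"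
    by (auto intro!: derivative_eq_intros)
  from DERIV_chain2[OF C this] DERIV_chain2[OF Sn this]
  show "((\<lambda>s. C (s - a)) has_real_derivative \<gamma> * Sn (x - a)) (at x within A)"
    "((\<lambda>s. Sn (s - a)) has_real_derivative C (x - a)) (at x within A)" by simp_all
qed

lemma integral_C: "y \<le> x \<Longrightarrow> integral {y..x} (\<lambda>s. C (s - a)) = Sn (x - a) - Sn (y - a)"
  by (intro integral_unique fundamental_theorem_of_calculus)
     (auto intro!: shift_derivative simp: has_real_derivative_iff_has_vector_derivative[symmetric])

lemma integral_Sn: "y \<le> x \<Longrightarrow> integral {y..x} (\<lambda>s. Sn (s - a)) = (C (x - a) - C (y - a)) / \<gamma>"
proof -
  assume "y \<le> x"
  then have "((\<lambda>s. \<gamma> * Sn (s - a)) has_integral (C (x - a) - C (y - a))) {y..x}"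
    by (intro fundamental_theorem_of_calculus)
       (auto intro!: shift_derivative simp: has_real_derivative_iff_has_vector_derivative[symmetric])
  then show ?thesis using \<gamma> by (auto simp: field_simps dest: integral_unique)
qed

text \<open>Variation of constants; the coefficient of \<open>C\<close> is forced by the Neumann condition at \<open>1\<close>.\<close>

definition green :: "l2 \<Rightarrow> l2" where
  "green g = (inner (abs_l2 (\<lambda>y. C (1 - y))) g / (\<gamma> * Sn 1)) *\<^sub>R abs_l2 C - volterra (\<lambda>x y. Sn (x - y)) g"

lemma bounded_linear_green: "bounded_linear green"
  unfolding green_def
  by (intro bounded_linear_sub bounded_linear_volterra continuous_on_subset[OF continuous_kernels(1)]
      bounded_linear_compose[OF bounded_linear_scaleR_left]
      bounded_linear_compose[OF bounded_linear_divide] bounded_linear_inner_right) auto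

text \<open>The check runs through primitives: each candidate derivative is integrated explicitly,
  with Fubini for the Volterra terms, so that no integral with an L2 integrand has to be
  differentiated.\<close>

lemma green_solves: "green g \<in> neumann_domain" "\<gamma> *\<^sub>R green g - neumann_laplacian (green g) = g"
proof -
  define a where "a = inner (abs_l2 (\<lambda>y. C (1 - y))) g / (\<gamma> * Sn 1)"
  let ?V1 = "volterra (\<lambda>x y. Sn (x - y)) g" and ?V2 = "volterra (\<lambda>x y. C (x - y)) g"
  \<comment> \<open>\<open>W\<close> and \<open>h\<close> are the formal first and second
    derivatives of \<open>green g\<close>. The diagonal term drops out of \<open>W\<close> because
    \<open>Sn 0 = 0\<close>, whereas \<open>C 0 = 1\<close> contributes \<open>- g\<close> to
    \<open>h\<close>.\<close>
  define W where "W = (a * \<gamma>) *\<^sub>R abs_l2 Sn - ?V2"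
  define h where "h = \<gamma> *\<^sub>R green g - g"
  have R: "green g = a *\<^sub>R abs_l2 C - ?V1" by (simp add: green_def a_def)
  have sq: "square_integrable C" "square_integrable Sn" "square_integrable (\<lambda>y. C (1 - y))"
    by (auto intro!: square_integrable_continuous continuous_C continuous_Sn
        continuous_on_compose2[OF continuous_C[of UNIV]] continuous_intros)
  note tri = continuous_on_subset[OF continuous_kernels(1) subset_UNIV]
    continuous_on_subset[OF continuous_kernels(2) subset_UNIV]
  have unit: "AE x in unit_measure. x \<in> {0<..<1}" by (simp add: AE_unit_iff)
  have int: "rep_l2 g integrable_on {0..x}" "(\<lambda>y. C (x - y) * rep_l2 g y) integrable_on {0..x}"
    if "0 \<le> x" "x \<le> 1" for x
    using rep_l2_absolutely_integrable[OF that] triangle_kernel_integrable[OF tri(2) that]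
    by (auto simp: absolutely_integrable_on_def)
  have "integral {0..x} (rep_l2 W) = a * (C x - 1) - integral {0..x} (\<lambda>y. Sn (x - y) * rep_l2 g y)"
    if x: "0 \<le> x" "x \<le> 1" for x
  proof -
    have "integral {0..x} (rep_l2 W) = a * \<gamma> * integral {0..x} Sn - integral {0..x} (rep_l2 ?V2)"
      using x sq by (simp add: W_def integral_rep_l2_minus integral_rep_l2_scaleR integral_rep_abs_l2)
    also have "integral {0..x} Sn = (C x - 1) / \<gamma>" using integral_Sn[of 0 x 0] x by (simp add: C0)
    also have "integral {0..x} (rep_l2 ?V2) = integral {0..x} (\<lambda>y. Sn (x - y) * rep_l2 g y)"
      unfolding integral_rep_volterra[OF continuous_kernels(2) x]
      by (rule Henstock_Kurzweil_Integration.integral_cong) (simp add: integral_C Sn0)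
    finally show ?thesis using \<gamma> by simp
  qed note IW = this
  have Ih: "integral {0..x} (rep_l2 h) = a * \<gamma> * Sn x - integral {0..x} (\<lambda>y. C (x - y) * rep_l2 g y)"
    if x: "0 \<le> x" "x \<le> 1" for x
  proof -
    have "integral {0..x} (rep_l2 h) = \<gamma> * (a * integral {0..x} C - integral {0..x} (rep_l2 ?V1)) - integral {0..x} (rep_l2 g)"
      using x sq by (simp add: h_def R integral_rep_l2_minus integral_rep_l2_scaleR integral_rep_abs_l2)
    also have "integral {0..x} C = Sn x" using integral_C[of 0 x 0] x by (simp add: Sn0)
    also have "integral {0..x} (rep_l2 ?V1) = integral {0..x} (\<lambda>y. (C (x - y) * rep_l2 g y - rep_l2 g y) / \<gamma>)"
      unfolding integral_rep_volterra[OF continuous_kernels(1) x]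
      by (rule Henstock_Kurzweil_Integration.integral_cong) (simp add: integral_Sn C0 field_simps \<gamma>)
    also have "\<dots> = (integral {0..x} (\<lambda>y. C (x - y) * rep_l2 g y) - integral {0..x} (rep_l2 g)) / \<gamma>"
      using int[OF x] by (simp add: Henstock_Kurzweil_Integration.integral_diff)
    finally show ?thesis
      using \<gamma> by (simp add: right_diff_distrib diff_divide_distrib)
  qed
  have z: "AE x in unit_measure. rep_l2 (green g) x = a + integral {0..x} (rep_l2 W)"
    using rep_l2_minus[of "a *\<^sub>R abs_l2 C" ?V1] rep_l2_scaleR[of a "abs_l2 C"] rep_abs_l2[OF sq(1)]
      rep_volterra[OF tri(1), of g] unit
    by eventually_elim (simp add: R IW algebra_simps)
  have w: "AE x in unit_measure. rep_l2 W x = integral {0..x} (rep_l2 h)"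
    using rep_l2_minus[of "(a * \<gamma>) *\<^sub>R abs_l2 Sn" ?V2] rep_l2_scaleR[of "a * \<gamma>" "abs_l2 Sn"] rep_abs_l2[OF sq(2)]
      rep_volterra[OF tri(2), of g] unit
    by eventually_elim (simp add: W_def Ih)
  \<comment> \<open>The inner product in \<open>a\<close> is the value at 1 of the integral in
    \<open>Ih\<close>, so the primitive of \<open>h\<close> vanishes there.\<close>
  have "inner (abs_l2 (\<lambda>y. C (1 - y))) g = (LINT y|unit_measure. C (1 - y) * rep_l2 g y)"
    using inner_abs_l2[OF sq(3) square_integrable_rep, of g] by simp
  also have "\<dots> = integral {0..1} (\<lambda>y. C (1 - y) * rep_l2 g y)"
    by (intro integral_unit_eq square_integrable_mult sq square_integrable_rep)
  finally have h1: "integral {0..1} (rep_l2 h) = 0"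
    using \<gamma> Sn1 by (simp add: Ih a_def)
  show "green g \<in> neumann_domain" "\<gamma> *\<^sub>R green g - neumann_laplacian (green g) = g"
    using neumann_domainI[OF z w h1] by (simp_all add: h_def)
qed

text \<open>The difference of two solutions and its weak derivative have continuous versions
  \<open>D\<close> and \<open>E\<close>. Inserted under the integral signs, these solve
  \<open>D' = E\<close> and \<open>E' = \<gamma> D\<close> classically on the closed interval with
  \<open>E\<close> zero at both ends, which leaves an ODE argument.\<close>

lemma shifted_laplacian_inj:
  assumes z: "z1 \<in> neumann_domain" "z2 \<in> neumann_domain"
    and eq: "\<gamma> *\<^sub>R z1 - neumann_laplacian z1 = \<gamma> *\<^sub>R z2 - neumann_laplacian z2"
  shows "z1 = z2"
proof -
  define z where "z = z1 - z2"
  define w where "w = wderiv z1 - wderiv z2"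
  have lap: "neumann_laplacian z1 - neumann_laplacian z2 = \<gamma> *\<^sub>R z"
    using eq unfolding z_def scaleR_diff_right by (metis add_diff_cancel_left' diff_add_cancel diff_diff_eq2 diff_diff_add)
  obtain c1 where 1: "AE x in unit_measure. rep_l2 z1 x = c1 + integral {0..x} (rep_l2 (wderiv z1))"
    "AE x in unit_measure. rep_l2 (wderiv z1) x = integral {0..x} (rep_l2 (neumann_laplacian z1))"
    "integral {0..1} (rep_l2 (neumann_laplacian z1)) = 0" using neumann_domainE[OF z(1)] by blast
  obtain c2 where 2: "AE x in unit_measure. rep_l2 z2 x = c2 + integral {0..x} (rep_l2 (wderiv z2))"
    "AE x in unit_measure. rep_l2 (wderiv z2) x = integral {0..x} (rep_l2 (neumann_laplacian z2))"
    "integral {0..1} (rep_l2 (neumann_laplacian z2)) = 0" using neumann_domainE[OF z(2)] by blast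
  have unit: "AE x in unit_measure. x \<in> {0<..<1}" by (simp add: AE_unit_iff)
  define c where "c = c1 - c2"
  define D where "D x = c + integral {0..x} (rep_l2 w)" for x
  define E where "E x = \<gamma> * integral {0..x} (rep_l2 z)" for x
  have lap_int: "integral {0..x} (rep_l2 (neumann_laplacian z1)) - integral {0..x} (rep_l2 (neumann_laplacian z2)) = E x"
    if "0 \<le> x" "x \<le> 1" for x
    using that integral_rep_l2_minus[OF that, of "neumann_laplacian z1" "neumann_laplacian z2"]
    by (simp add: lap integral_rep_l2_scaleR E_def)
  have zD: "AE x in unit_measure. rep_l2 z x = D x"
    using 1(1) 2(1) rep_l2_minus[of z1 z2] unit
    by eventually_elim (simp add: z_def D_def c_def w_def integral_rep_l2_minus)
  have wE: "AE x in unit_measure. rep_l2 w x = E x"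
    using 1(2) 2(2) rep_l2_minus[of "wderiv z1" "wderiv z2"] unit
    by eventually_elim (simp add: w_def lap_int)
  have E01: "E 0 = 0" "E 1 = 0" using lap_int[of 1] 1(3) 2(3) by (simp_all add: E_def)
  have cont: "continuous_on {0..1} D" "continuous_on {0..1} E"
    unfolding D_def E_def by (intro continuous_intros continuous_primitive)+
  have dD: "(D has_real_derivative E x) (at x within {0..1})" if "x \<in> {0..1}" for x
  proof -
    have der: "((\<lambda>x. c + integral {0..x} E) has_real_derivative E x) (at x within {0..1})"
      using integral_has_real_derivative[OF cont(2) that] by (auto intro!: derivative_eq_intros)
    have eq: "D x = c + integral {0..x} E" if "x \<in> {0..1}" for x
      unfolding D_def using AE_unit_integral_cong[OF wE, of x] that by simp
    show ?thesis
      by (rule has_field_derivative_transform_within[OF der, of 1]) (use that eq in simp_all)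
  qed
  have dE: "(E has_real_derivative \<gamma> * D x) (at x within {0..1})" if "x \<in> {0..1}" for x
  proof -
    have der: "((\<lambda>x. \<gamma> * integral {0..x} D) has_real_derivative \<gamma> * D x) (at x within {0..1})"
      using integral_has_real_derivative[OF cont(1) that] by (auto intro!: derivative_eq_intros)
    have eq: "E x = \<gamma> * integral {0..x} D" if "x \<in> {0..1}" for x
      unfolding E_def using AE_unit_integral_cong[OF zD, of x] that by simp
    show ?thesis
      by (rule has_field_derivative_transform_within[OF der, of 1]) (use that eq in simp_all)
  qed
  have d: "(C has_real_derivative \<gamma> * Sn x) (at x within A)" "(Sn has_real_derivative C x) (at x within A)" for x A
    using C Sn has_field_derivative_at_within by blast+
  \<comment> \<open>The Wronskians of \<open>D\<close> with \<open>C\<close> and with \<open>Sn\<close> are constant, and both vanish at an end point.\<close>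
  have "\<exists>k. \<forall>x\<in>{0..1}. D x * (\<gamma> * Sn x) - E x * C x = k"
    by (rule has_field_derivative_zero_constant)
       (auto intro!: derivative_eq_intros dD dE d simp: algebra_simps)
  then have F1: "D x * (\<gamma> * Sn x) = E x * C x" if "x \<in> {0..1}" for x
    using that E01 Sn0 by (metis atLeastAtMost_iff diff_eq_eq diff_self mult_zero_left mult_zero_right order_refl zero_le_one)
  \<comment> \<open>The eigenvalue condition enters here: \<open>E 1 = 0\<close> leaves
    \<open>D 1 * (\<gamma> * Sn 1) = 0\<close>.\<close>
  have D1: "D 1 = 0" using F1[of 1] E01 \<gamma> Sn1 by simp
  have "\<exists>k. \<forall>x\<in>{0..1}. D x * C x - E x * Sn x = k"
    by (rule has_field_derivative_zero_constant)
       (auto intro!: derivative_eq_intros dD dE d simp: algebra_simps)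
  then have F2: "D x * C x = E x * Sn x" if "x \<in> {0..1}" for x
    using that E01 D1 by (metis atLeastAtMost_iff diff_eq_eq diff_self mult_zero_left order_refl zero_le_one add.left_neutral)
  have D0: "D x = 0" if "x \<in> {0..1}" for x
  proof -
    \<comment> \<open>Eliminating \<open>E\<close> from the two relations leaves \<open>D x\<close>
      times the Wronskian of \<open>C\<close> and \<open>Sn\<close>, which is 1.\<close>
    have "D x = D x * ((C x)\<^sup>2 - \<gamma> * (Sn x)\<^sup>2)" by (simp add: pythagoras)
    also have "\<dots> = (D x * C x) * C x - (D x * (\<gamma> * Sn x)) * Sn x" by (simp add: power2_eq_square algebra_simps)
    also have "\<dots> = 0" using F1[OF that] F2[OF that] by simp
    finally show ?thesis .
  qed
  have "AE x in unit_measure. rep_l2 z1 x = rep_l2 z2 x"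
    using zD rep_l2_minus[of z1 z2] unit by eventually_elim (simp add: z_def D0)
  then show ?thesis by (rule l2_eqI)
qed

lemma neumann_resolvent_eq: "neumann_resolvent \<gamma> = green"
  unfolding neumann_resolvent_def
  by (intro ext inv_into_f_eq inj_onI) (auto simp: green_solves shifted_laplacian_inj)

end

text \<open>The excluded values act twice: \<open>n = 0\<close> rules out
  \<open>\<gamma> = 0\<close>, and positive \<open>n\<close> keep \<open>sin r\<close> away from
  zero when \<open>\<gamma>\<close> is negative. For positive \<open>\<gamma>\<close> the hyperbolic
  pair serves, as \<open>sinh\<close> vanishes only at 0.\<close>

lemma bounded_linear_neumann_resolvent:
  assumes "\<And>n::nat. \<gamma> \<noteq> - (real n * pi)\<^sup>2"
  shows "bounded_linear (neumann_resolvent \<gamma>)"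
proof -
  have "\<gamma> \<noteq> 0" using assms[of 0] by simp
  then consider "\<gamma> > 0" | "\<gamma> < 0" by linarith
  then have "\<exists>C Sn. fundamental_pair \<gamma> C Sn"
  proof cases
    case 1
    define r where "r = sqrt \<gamma>"
    have r: "r > 0" "r * r = \<gamma>" using 1 by (auto simp: r_def)
    have "fundamental_pair \<gamma> (\<lambda>x. cosh (r * x)) (\<lambda>x. sinh (r * x) / r)"
      by unfold_locales (use r in \<open>auto intro!: derivative_eq_intros simp: field_simps\<close>)
    then show ?thesis by blast
  next
    case 2
    define r where "r = sqrt (- \<gamma>)"
    have r: "r > 0" "r * r = - \<gamma>" using 2 by (auto simp: r_def)
    then have \<gamma>: "\<gamma> = - (r * r)" by simp
    have "sin r \<noteq> 0"
    proof
      assume "sin r = 0"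
      then obtain i :: int where i: "r = of_int i * pi" by (auto simp: sin_zero_iff_int2)
      then have "i > 0" using r(1) by (simp add: zero_less_mult_iff)
      then have "r = real (nat i) * pi" using i by simp
      then show False using assms[of "nat i"] r(2) by (simp add: power2_eq_square)
    qed
    then have "fundamental_pair \<gamma> (\<lambda>x. cos (r * x)) (\<lambda>x. sin (r * x) / r)"
      unfolding \<gamma> by unfold_locales (use r(1) in \<open>auto intro!: derivative_eq_intros simp: field_simps\<close>)
    then show ?thesis by blast
  qed
  then obtain C Sn where "fundamental_pair \<gamma> C Sn" by blast
  then show ?thesis
    by (simp add: fundamental_pair.neumann_resolvent_eq fundamental_pair.bounded_linear_green)
qed

section \<open>Mild solutions of semilinear equations\<close>

text \<open>Baire category: the closed sets \<open>E m\<close> cover the complete space, so one of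
  them contains a ball, and a uniform bound on a ball gives a bound on operator norms.\<close>

lemma uniform_boundedness:
  fixes T :: "'i \<Rightarrow> 'a::banach \<Rightarrow> 'b::real_normed_vector"
  assumes lin: "\<And>i. bounded_linear (T i)" and bdd: "\<And>x. \<exists>B. \<forall>i. norm (T i x) \<le> B"
  shows "\<exists>M. \<forall>i x. norm (T i x) \<le> M * norm x"
proof -
  define E where "E m = {x. \<forall>i. norm (T i x) \<le> real m}" for m :: nat
  have closed_E: "closed (E m)" for m
    unfolding E_def
    by (intro closed_Collect_all closed_Collect_le continuous_intros
        bounded_linear.continuous_on[OF lin])
  have "\<exists>m. x \<in> E m" for x
  proof -
    obtain B where B: "\<And>i. norm (T i x) \<le> B" using bdd by blast
    obtain m :: nat where "B \<le> real m" using real_arch_simple by blast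
    then show ?thesis using B unfolding E_def by (blast intro: order_trans)
  qed
  then have UN: "\<Union>(range E) = UNIV" by auto
  have "\<exists>m. interior (E m) \<noteq> {}"
  proof (rule ccontr)
    assume "\<nexists>m. interior (E m) \<noteq> {}"
    then have "euclidean interior_of \<Union>(range E) = {}"
      using closed_E
      by (intro Baire_category_alt) (auto simp: completely_metrizable_space_euclidean)
    then show False by (simp add: UN)
  qed
  then obtain m x0 where "x0 \<in> interior (E m)" by blast
  then obtain r where r: "r > 0" "cball x0 r \<subseteq> E m"
    by (auto simp: mem_interior_cball)
  have "norm (T i x) \<le> (2 * real m / r) * norm x" for i x
  proof (cases "x = 0")
    case True
    then show ?thesis by (simp add: lin linear_0 bounded_linear.linear)
  next
    case False
    interpret bounded_linear "T i" by (rule lin)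
    \<comment> \<open>\<open>x\<close> is rescaled to the radius of the ball; \<open>T i y\<close>
      is the difference of the values at \<open>x0 + y\<close> and \<open>x0\<close>, which accounts
      for the factor 2.\<close>
    define y where "y = (r / norm x) *\<^sub>R x"
    have "norm y = r" using False r by (simp add: y_def)
    then have "x0 + y \<in> E m" "x0 \<in> E m" using r by (auto simp: subset_iff dist_norm)
    then have "norm (T i (x0 + y)) \<le> m" "norm (T i x0) \<le> m" unfolding E_def by auto
    then have "norm (T i y) \<le> 2 * m"
      using norm_triangle_ineq4[of "T i (x0 + y)" "T i x0"] by (simp add: add)
    then have "r / norm x * norm (T i x) \<le> 2 * m"
      using r by (simp add: y_def scaleR)
    then show ?thesis using False r by (simp add: field_simps)
  qed
  then show ?thesis by blast
qed

section \<open>Local bounds and continuity of semigroups\<close>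

lemma C0_semigroup_tendsto_0:
  assumes S: "C0_semigroup S"
  shows "((\<lambda>t. S t z) \<longlongrightarrow> z) (at 0 within {0..})"
proof -
  have "at (0::real) within {0..} = at_right 0"
    by (intro at_within_nhd[of _ UNIV]) auto
  then show ?thesis using S by (simp add: C0_semigroup_def)
qed

text \<open>Without such a bound there are times tending to 0 at which the operator norms are
  unbounded. Every orbit converges along these times and so is bounded, contradicting uniform
  boundedness.\<close>

lemma C0_semigroup_bounded_near_0:
  fixes S :: "real \<Rightarrow> 'a::banach \<Rightarrow> 'a"
  assumes S: "C0_semigroup S"
  shows "\<exists>\<delta>>0. \<exists>M. \<forall>t\<in>{0..\<delta>}. \<forall>z. norm (S t z) \<le> M * norm z"
proof (rule ccontr)
  assume "\<not> ?thesis"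
  then have "\<exists>t z. 0 \<le> t \<and> t \<le> \<delta> \<and> norm (S t z) > M * norm z" if "\<delta> > 0" for \<delta> M
    using that by (meson atLeastAtMost_iff not_le)
  then have "\<forall>n::nat. \<exists>t z. 0 \<le> t \<and> t \<le> inverse (real (Suc n)) \<and> norm (S t z) > real n * norm z"
    by simp
  then obtain t z where t: "\<And>n::nat. 0 \<le> t n" "\<And>n. t n \<le> inverse (real (Suc n))"
    and z: "\<And>n. norm (S (t n) (z n)) > real n * norm (z n)" by metis
  have t0: "t \<longlonglongrightarrow> 0"
    by (rule tendsto_sandwich[OF _ _ tendsto_const LIMSEQ_inverse_real_of_nat])
      (use t in auto)
  have "(\<lambda>n. S (t n) x) \<longlonglongrightarrow> x" for x
  proof -
    have "continuous (at 0 within {0..}) (\<lambda>t. S t x)"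
      using C0_semigroup_tendsto_0[OF S, of x] S by (simp add: continuous_within C0_semigroup_def)
    then have "(\<lambda>n. S (t n) x) \<longlonglongrightarrow> S 0 x"
      by (rule continuous_within_tendsto_compose[where f="\<lambda>t. S t x"]) (use t t0 in auto)
    then show ?thesis using S by (simp add: C0_semigroup_def)
  qed
  then have "\<exists>B. \<forall>n. norm (S (t n) x) \<le> B" for x
    using convergent_imp_Bseq[of "\<lambda>n. S (t n) x"] by (auto simp: convergent_def Bseq_def)
  moreover have "bounded_linear (S (t n))" for n
    using S t by (simp add: C0_semigroup_def)
  ultimately obtain M where M: "\<And>n x. norm (S (t n) x) \<le> M * norm x"
    using uniform_boundedness[of "\<lambda>n. S (t n)"] by blast
  obtain n :: nat where "M \<le> n" using real_arch_simple by blast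
  then have "M * norm (z n) \<le> n * norm (z n)" by (intro mult_right_mono) auto
  with z[of n] M[of n "z n"] show False by linarith
qed

lemma C0_semigroup_bounded:
  fixes S :: "real \<Rightarrow> 'a::banach \<Rightarrow> 'a"
  assumes S: "C0_semigroup S"
  obtains M where "M > 0" "\<And>t z. 0 \<le> t \<Longrightarrow> t \<le> T \<Longrightarrow> norm (S t z) \<le> M * norm z"
proof -
  obtain \<delta> M where d: "\<delta> > 0" and M: "\<And>t z. 0 \<le> t \<Longrightarrow> t \<le> \<delta> \<Longrightarrow> norm (S t z) \<le> M * norm z"
    using C0_semigroup_bounded_near_0[OF S] by fastforce
  \<comment> \<open>A constant of at least 1 makes the powers increase with the number of steps of
    length \<open>\<delta>\<close>.\<close>
  define N where "N = max M 1"
  have N: "norm (S t z) \<le> N * norm z" if "0 \<le> t" "t \<le> \<delta>" for t z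
    by (rule order_trans[OF M[OF that]]) (simp add: N_def mult_right_mono)
  have pow: "norm (S t z) \<le> N ^ Suc n * norm z" if "0 \<le> t" "t \<le> Suc n * \<delta>" for t z n
    using that
  proof (induction n arbitrary: t)
    case 0
    then show ?case using N[of t z] by simp
  next
    case (Suc n)
    show ?case
    proof (cases "t \<le> \<delta>")
      case True
      have "N * 1 \<le> N * N ^ Suc n" by (intro mult_left_mono one_le_power) (auto simp: N_def)
      then show ?thesis
        using N[OF Suc.prems(1) True, of z] mult_right_mono[of N "N ^ Suc (Suc n)" "norm z"]
        by (simp add: N_def)
    next
      case False
      have "S t z = S (\<delta> + (t - \<delta>)) z" by simp
      also have "\<dots> = S \<delta> (S (t - \<delta>) z)"
        using S False d unfolding C0_semigroup_def by (metis diff_ge_0_iff_ge less_eq_real_def not_le)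
      also have "norm \<dots> \<le> N * norm (S (t - \<delta>) z)" using d by (intro N) auto
      also have "\<dots> \<le> N * (N ^ Suc n * norm z)"
        using False Suc.prems by (intro mult_left_mono Suc.IH) (auto simp: algebra_simps N_def)
      finally show ?thesis by (simp add: mult.assoc)
    qed
  qed
  obtain n :: nat where n: "T / \<delta> \<le> n" using real_arch_simple by blast
  then have "T \<le> Suc n * \<delta>" using d by (simp add: field_simps)
  then show ?thesis
    using that[of "N ^ Suc n"] pow[of _ n] by (auto simp: N_def intro!: zero_less_mult_iff[THEN iffD2])
qed

text \<open>Factoring out the operator at the earlier time reduces continuity from either side to
  right continuity at 0, with the uniform bound controlling the factor.\<close>

lemma C0_semigroup_continuous:
  fixes S :: "real \<Rightarrow> 'a::banach \<Rightarrow> 'a"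
  assumes S: "C0_semigroup S"
  shows "continuous_on {0..T} (\<lambda>t. S t z)"
proof -
  obtain M where M: "M > 0" "\<And>t z. 0 \<le> t \<Longrightarrow> t \<le> T \<Longrightarrow> norm (S t z) \<le> M * norm z"
    by (rule C0_semigroup_bounded[OF S, of T]) blast
  have diff: "norm (S t z - S s z) \<le> M * norm (S (t - s) z - z)" if "0 \<le> s" "s \<le> t" "t \<le> T" for s t
  proof -
    have "S (s + (t - s)) z = S s (S (t - s) z)"
      using S that unfolding C0_semigroup_def by (meson diff_ge_0_iff_ge)
    moreover have "bounded_linear (S s)" using S that by (simp add: C0_semigroup_def)
    ultimately have "S t z - S s z = S s (S (t - s) z - z)"
      by (simp add: linear_diff bounded_linear.linear)
    then show ?thesis using M(2)[of s "S (t - s) z - z"] that by simp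
  qed
  show ?thesis
    unfolding continuous_on_iff
  proof (intro ballI allI impI)
    fix x e :: real
    assume x: "x \<in> {0..T}" and e: "0 < e"
    have "\<forall>\<^sub>F h in at 0 within {0..}. dist (S h z) z < e / M"
      using C0_semigroup_tendsto_0[OF S, of z] e M(1) by (intro tendstoD) auto
    then obtain d where d: "d > 0" "\<And>h. h \<ge> 0 \<Longrightarrow> h \<noteq> 0 \<Longrightarrow> h < d \<Longrightarrow> dist (S h z) z < e / M"
      unfolding eventually_at by (auto simp: dist_real_def)
    have S0: "S 0 z = z" using S by (simp add: C0_semigroup_def)
    have h: "M * norm (S h z - z) < e" if "h \<ge> 0" "h < d" for h
      using d(2)[OF that(1) _ that(2)] e M(1) S0 by (cases "h = 0") (auto simp: dist_norm field_simps)
    show "\<exists>d>0. \<forall>x'\<in>{0..T}. dist x' x < d \<longrightarrow> dist (S x' z) (S x z) < e"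
    proof (intro exI conjI ballI impI)
      fix x' assume x': "x' \<in> {0..T}" "dist x' x < d"
      show "dist (S x' z) (S x z) < e"
      proof (cases "x \<le> x'")
        case True
        then show ?thesis using diff[of x x'] h[of "x' - x"] x x'
          by (auto simp: dist_norm)
      next
        case False
        then show ?thesis using diff[of x' x] h[of "x - x'"] x x'
          by (auto simp: dist_norm norm_minus_commute[of "S x' z"])
      qed
    qed (use d in auto)
  qed
qed

lemma C0_semigroup_continuous_joint:
  fixes S :: "real \<Rightarrow> 'a::banach \<Rightarrow> 'a"
  assumes S: "C0_semigroup S" and p: "continuous_on A p" "p ` A \<subseteq> {0..T}" and g: "continuous_on A g"
  shows "continuous_on A (\<lambda>a. S (p a) (g a))"
  unfolding continuous_on_def
proof
  fix a assume a: "a \<in> A"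
  obtain M where M: "M > 0" "\<And>t z. 0 \<le> t \<Longrightarrow> t \<le> T \<Longrightarrow> norm (S t z) \<le> M * norm z"
    by (rule C0_semigroup_bounded[OF S, of T]) blast
  have "continuous_on A (\<lambda>b. S (p b) (g a))"
    using continuous_on_compose2[OF C0_semigroup_continuous[OF S] p(1), of T] p(2) by simp
  then have "((\<lambda>b. S (p b) (g a)) \<longlongrightarrow> S (p a) (g a)) (at a within A)"
    using a by (simp add: continuous_on_def)
  moreover have "((\<lambda>b. S (p b) (g b) - S (p b) (g a)) \<longlongrightarrow> 0) (at a within A)"
  proof (rule Lim_null_comparison)
    show "\<forall>\<^sub>F b in at a within A. norm (S (p b) (g b) - S (p b) (g a)) \<le> M * norm (g b - g a)"
      unfolding eventually_at_filter
    proof (intro always_eventually allI impI)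
      fix b assume "b \<in> A"
      then have pb: "0 \<le> p b" "p b \<le> T" using p by auto
      then have "bounded_linear (S (p b))" using S by (simp add: C0_semigroup_def)
      then have "S (p b) (g b) - S (p b) (g a) = S (p b) (g b - g a)"
        by (simp add: linear_diff bounded_linear.linear)
      then show "norm (S (p b) (g b) - S (p b) (g a)) \<le> M * norm (g b - g a)"
        using M(2)[OF pb] by simp
    qed
    have "(g \<longlongrightarrow> g a) (at a within A)" using g a by (simp add: continuous_on_def)
    then show "((\<lambda>b. M * norm (g b - g a)) \<longlongrightarrow> 0) (at a within A)"
      by (intro tendsto_mult_right_zero tendsto_norm_zero) (simp add: LIM_zero)
  qed
  ultimately show "((\<lambda>b. S (p b) (g b)) \<longlongrightarrow> S (p a) (g a)) (at a within A)"
    using tendsto_add by fastforce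
qed

lemma continuous_on_atLeastI:
  fixes f :: "real \<Rightarrow> 'a::topological_space"
  assumes "\<And>T. continuous_on {a..T} f"
  shows "continuous_on {a..} f"
  unfolding continuous_on_def
proof
  fix x assume x: "x \<in> {a..}"
  have "at x within {a..} = at x within {a..x + 1}"
    by (intro at_within_nhd[of _ "{..<x + 1}"]) auto
  then show "(f \<longlongrightarrow> f x) (at x within {a..})"
    using assms[of "x + 1"] x by (auto simp: continuous_on_def)
qed

text \<open>Freezing the semigroup at time \<open>0\<close> for \<open>\<tau> > t\<close> turns the convolution into a parameter
  integral over a fixed interval.\<close>

lemma C0_semigroup_convolution_continuous:
  fixes S :: "real \<Rightarrow> 'a::banach \<Rightarrow> 'a"
  assumes S: "C0_semigroup S" and g: "continuous_on {0..} g"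
  shows "continuous_on {0..} (\<lambda>t. integral {0..t} (\<lambda>\<tau>. S (t - \<tau>) (g \<tau>)))"
proof (rule continuous_on_atLeastI)
  fix T :: real
  have gT: "continuous_on {0..T} g" by (rule continuous_on_subset[OF g]) auto
  define H where "H t \<tau> = S (max 0 (t - \<tau>)) (g \<tau>)" for t \<tau>
  have H: "continuous_on ({0..T} \<times> cbox 0 T) (\<lambda>(t, \<tau>). H t \<tau>)"
    unfolding H_def case_prod_beta
    by (rule C0_semigroup_continuous_joint[OF S, where T = T])
       (auto intro!: continuous_intros continuous_on_compose2[OF gT])
  have Ht: "continuous_on {0..T} (H t)" if "t \<in> {0..T}" for t
  proof -
    have "continuous_on {0..T} (\<lambda>\<tau>. (t, \<tau>))" by (intro continuous_intros)
    then show ?thesis using continuous_on_compose2[OF H, of "{0..T}" "\<lambda>\<tau>. (t, \<tau>)"] that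
      by (auto simp: image_subset_iff)
  qed
  have "integral {0..t} (\<lambda>\<tau>. S (t - \<tau>) (g \<tau>)) = integral {0..T} (H t) - integral {t..T} g"
    if t: "t \<in> {0..T}" for t
  proof -
    have "integral {0..t} (H t) + integral {t..T} (H t) = integral {0..T} (H t)"
      using t by (intro Henstock_Kurzweil_Integration.integral_combine integrable_continuous_interval Ht) auto
    moreover have "integral {0..t} (H t) = integral {0..t} (\<lambda>\<tau>. S (t - \<tau>) (g \<tau>))"
      by (intro Henstock_Kurzweil_Integration.integral_cong) (auto simp: H_def max_def)
    moreover have "integral {t..T} (H t) = integral {t..T} g"
      using S by (intro Henstock_Kurzweil_Integration.integral_cong) (auto simp: H_def max_def C0_semigroup_def)
    ultimately show ?thesis by (simp add: algebra_simps)
  qed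
  moreover have "continuous_on {0..T} (\<lambda>t. integral {0..T} (H t) - integral {t..T} g)"
    using integral_continuous_on_param[OF H]
    by (intro continuous_intros indefinite_integral_continuous_1' integrable_continuous_interval gT) auto
  ultimately show "continuous_on {0..T} (\<lambda>t. integral {0..t} (\<lambda>\<tau>. S (t - \<tau>) (g \<tau>)))"
    using continuous_on_cong[OF refl, of "{0..T}"
        "\<lambda>t. integral {0..t} (\<lambda>\<tau>. S (t - \<tau>) (g \<tau>))" "\<lambda>t. integral {0..T} (H t) - integral {t..T} g"]
    by blast
qed

section \<open>Duhamel's formula as a fixed point equation\<close>

definition duhamel :: "(real \<Rightarrow> 'a \<Rightarrow> 'a::banach) \<Rightarrow> ('a \<Rightarrow> 'a) \<Rightarrow> 'a \<Rightarrow> (real \<Rightarrow> 'a) \<Rightarrow> real \<Rightarrow> 'a" where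
  "duhamel S F u0 u t = S t u0 + integral {0..t} (\<lambda>\<tau>. S (t - \<tau>) (F (u \<tau>)))"

lemma duhamel_continuous:
  assumes S: "C0_semigroup S" and F: "continuous_on UNIV F" and u: "continuous_on {0..} u"
  shows "continuous_on {0..} (duhamel S F u0 u)"
  unfolding duhamel_def
  by (intro continuous_intros C0_semigroup_convolution_continuous[OF S]
      continuous_on_atLeastI[OF C0_semigroup_continuous[OF S]] continuous_on_compose2[OF F u]) auto

text \<open>The weight \<open>exp (a t)\<close> gives a contraction on every interval \<open>[0, T]\<close> at once, so that no
  continuation argument is needed.\<close>

lemma duhamel_contraction:
  fixes S :: "real \<Rightarrow> 'a::banach \<Rightarrow> 'a"
  assumes S: "C0_semigroup S" and F: "L-lipschitz_on UNIV F"
  obtains a where "\<And>u w K t. continuous_on {0..} u \<Longrightarrow> continuous_on {0..} w \<Longrightarrow>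
      (\<And>\<tau>. \<tau> \<in> {0..T} \<Longrightarrow> norm (u \<tau> - w \<tau>) \<le> K * exp (a * \<tau>)) \<Longrightarrow> t \<in> {0..T} \<Longrightarrow>
      norm (duhamel S F u0 u t - duhamel S F u0 w t) \<le> K / 2 * exp (a * t)"
proof -
  obtain M where M: "M > 0" "\<And>t z. 0 \<le> t \<Longrightarrow> t \<le> T \<Longrightarrow> norm (S t z) \<le> M * norm z"
    by (rule C0_semigroup_bounded[OF S, of T]) blast
  have L: "L \<ge> 0" using F by (rule lipschitz_on_nonneg)
  \<comment> \<open>The factor 2 produces the contraction constant 1/2 after integrating the
    exponential; the summand 1 keeps \<open>a\<close> positive even if \<open>L = 0\<close>.\<close>
  define a where "a = 2 * M * L + 1"
  have a: "a > 0" "M * L \<le> a / 2" using M L by (auto simp: a_def intro: add_nonneg_pos)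
  have Fc: "continuous_on UNIV F" by (rule lipschitz_on_continuous_on[OF F])
  show ?thesis
  proof (rule that[of a])
    fix u w :: "real \<Rightarrow> 'a" and K t
    assume u: "continuous_on {0..} u" and w: "continuous_on {0..} w"
      and le: "\<And>\<tau>. \<tau> \<in> {0..T} \<Longrightarrow> norm (u \<tau> - w \<tau>) \<le> K * exp (a * \<tau>)" and t: "t \<in> {0..T}"
    \<comment> \<open>The sign of \<open>K\<close> is read off from the bound at time 0; it allows
      the contribution of the lower limit to be dropped below.\<close>
    have "0 \<le> norm (u 0 - w 0)" by simp
    also have "\<dots> \<le> K" using le[of 0] t by simp
    finally have K: "K \<ge> 0" .
    have cont: "continuous_on {0..t} (\<lambda>\<tau>. S (t - \<tau>) (F (x \<tau>)))"
      if "continuous_on {0..} x" for x :: "real \<Rightarrow> 'a"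
      using t by (intro C0_semigroup_continuous_joint[OF S, where T = T] continuous_intros
          continuous_on_compose2[OF Fc] continuous_on_subset[OF that]) auto
    have i: "(\<lambda>\<tau>. S (t - \<tau>) (F (x \<tau>))) integrable_on {0..t}"
      if "continuous_on {0..} x" for x :: "real \<Rightarrow> 'a"
      by (intro integrable_continuous_interval cont that)
    have I: "((\<lambda>\<tau>. a / 2 * K * exp (a * \<tau>)) has_integral
        (K / 2 * exp (a * t) - K / 2 * exp (a * 0))) {0..t}"
      using t by (intro fundamental_theorem_of_calculus)
        (auto intro!: derivative_eq_intros simp: has_real_derivative_iff_has_vector_derivative[symmetric])
    have "duhamel S F u0 u t - duhamel S F u0 w t =
        integral {0..t} (\<lambda>\<tau>. S (t - \<tau>) (F (u \<tau>)) - S (t - \<tau>) (F (w \<tau>)))"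
      by (simp add: duhamel_def Henstock_Kurzweil_Integration.integral_diff[OF i[OF u] i[OF w]])
    also have "norm \<dots> \<le> integral {0..t} (\<lambda>\<tau>. a / 2 * K * exp (a * \<tau>))"
    proof (rule integral_norm_bound_integral)
      show "(\<lambda>\<tau>. S (t - \<tau>) (F (u \<tau>)) - S (t - \<tau>) (F (w \<tau>))) integrable_on {0..t}"
        by (intro integrable_diff i u w)
      show "(\<lambda>\<tau>. a / 2 * K * exp (a * \<tau>)) integrable_on {0..t}" using I by blast
      fix \<tau> assume \<tau>: "\<tau> \<in> {0..t}"
      have "bounded_linear (S (t - \<tau>))" using S \<tau> by (simp add: C0_semigroup_def)
      then have "S (t - \<tau>) (F (u \<tau>)) - S (t - \<tau>) (F (w \<tau>)) = S (t - \<tau>) (F (u \<tau>) - F (w \<tau>))"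
        by (simp add: linear_diff bounded_linear.linear)
      also have "norm \<dots> \<le> M * norm (F (u \<tau>) - F (w \<tau>))" using M(2) t \<tau> by auto
      also have "\<dots> \<le> M * (L * norm (u \<tau> - w \<tau>))"
        using M(1) lipschitz_onD[OF F, of "u \<tau>" "w \<tau>"] by (intro mult_left_mono) (auto simp: dist_norm)
      also have "\<dots> = M * L * norm (u \<tau> - w \<tau>)" by simp
      also have "\<dots> \<le> a / 2 * (K * exp (a * \<tau>))"
        using a le[of \<tau>] t \<tau> by (intro mult_mono) auto
      finally show "norm (S (t - \<tau>) (F (u \<tau>)) - S (t - \<tau>) (F (w \<tau>))) \<le> a / 2 * K * exp (a * \<tau>)"
        by simp
    qed
    also have "\<dots> = K / 2 * exp (a * t) - K / 2" using integral_unique[OF I] by simp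
    also have "\<dots> \<le> K / 2 * exp (a * t)" using K by simp
    finally show "norm (duhamel S F u0 u t - duhamel S F u0 w t) \<le> K / 2 * exp (a * t)" .
  qed
qed

text \<open>The weighted difference is bounded on the compact interval, and each application of the
  contraction halves the bound.\<close>

lemma duhamel_unique:
  fixes S :: "real \<Rightarrow> 'a::banach \<Rightarrow> 'a"
  assumes S: "C0_semigroup S" and F: "L-lipschitz_on UNIV F"
    and u: "continuous_on {0..} u" "\<And>t. t \<ge> 0 \<Longrightarrow> u t = duhamel S F u0 u t"
    and w: "continuous_on {0..} w" "\<And>t. t \<ge> 0 \<Longrightarrow> w t = duhamel S F u0 w t"
    and T: "T \<ge> 0"
  shows "u T = w T"
proof -
  obtain a where a: "\<And>u w K t. continuous_on {0..} u \<Longrightarrow> continuous_on {0..} w \<Longrightarrow>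
      (\<And>\<tau>. \<tau> \<in> {0..T} \<Longrightarrow> norm (u \<tau> - w \<tau>) \<le> K * exp (a * \<tau>)) \<Longrightarrow> t \<in> {0..T} \<Longrightarrow>
      norm (duhamel S F u0 u t - duhamel S F u0 w t) \<le> K / 2 * exp (a * t)"
    using duhamel_contraction[OF S F] by metis
  have "continuous_on {0..T} (\<lambda>t. norm (u t - w t) * exp (- a * t))"
    by (intro continuous_intros continuous_on_subset[OF u(1)] continuous_on_subset[OF w(1)]) auto
  then obtain K where K: "\<And>t. t \<in> {0..T} \<Longrightarrow> norm (u t - w t) * exp (- a * t) \<le> K"
    using continuous_attains_sup[of "{0..T}" "\<lambda>t. norm (u t - w t) * exp (- a * t)"] T by fastforce
  have le: "norm (u t - w t) \<le> K * (1/2)^n * exp (a * t)" if "t \<in> {0..T}" for n t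
    using that
  proof (induction n arbitrary: t)
    case 0
    then show ?case using K[of t] by (simp add: exp_minus field_simps)
  next
    case (Suc n)
    then show ?case using a[OF u(1) w(1), of "K * (1/2)^n" t] u(2)[of t] w(2)[of t] by simp
  qed
  have "(\<lambda>n. K * (1/2)^n * exp (a * T)) \<longlonglongrightarrow> K * 0 * exp (a * T)"
    by (intro tendsto_intros LIMSEQ_realpow_zero) auto
  then have "norm (u T - w T) \<le> K * 0 * exp (a * T)"
    by (rule LIMSEQ_le_const) (use le T in auto)
  then show ?thesis by simp
qed

lemma duhamel_fixpoint_exists:
  fixes S :: "real \<Rightarrow> 'a::banach \<Rightarrow> 'a"
  assumes S: "C0_semigroup S" and F: "L-lipschitz_on UNIV F"
  shows "\<exists>u. continuous_on {0..} u \<and> (\<forall>t\<ge>0. u t = duhamel S F u0 u t)"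
proof -
  let ?\<Phi> = "duhamel S F u0"
  define X where "X n = (?\<Phi> ^^ n) (\<lambda>_. u0)" for n
  have X_Suc: "X (Suc n) = ?\<Phi> (X n)" for n by (simp add: X_def)
  have Fc: "continuous_on UNIV F" by (rule lipschitz_on_continuous_on[OF F])
  have X: "continuous_on {0..} (X n)" for n
  proof (induction n)
    case 0
    show ?case by (simp add: X_def)
  next
    case (Suc n)
    then show ?case unfolding X_Suc by (rule duhamel_continuous[OF S Fc])
  qed
  \<comment> \<open>A telescoping series defines the limit for all times before any \<open>T\<close>
    is fixed, and brings it into the form of the Weierstrass test.\<close>
  define u where "u t = X 0 t + (\<Sum>i. X (Suc i) t - X i t)" for t
  have lim: "uniform_limit {0..T} X u sequentially" for T
  proof (cases "T \<ge> 0")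
    case True
    obtain a where a: "\<And>u w K t. continuous_on {0..} u \<Longrightarrow> continuous_on {0..} w \<Longrightarrow>
        (\<And>\<tau>. \<tau> \<in> {0..T} \<Longrightarrow> norm (u \<tau> - w \<tau>) \<le> K * exp (a * \<tau>)) \<Longrightarrow> t \<in> {0..T} \<Longrightarrow>
        norm (duhamel S F u0 u t - duhamel S F u0 w t) \<le> K / 2 * exp (a * t)"
      using duhamel_contraction[OF S F] by metis
    have "continuous_on {0..T} (\<lambda>t. norm (X 1 t - X 0 t) * exp (- a * t))"
      by (intro continuous_intros continuous_on_subset[OF X]) auto
    then obtain K where K: "\<And>t. t \<in> {0..T} \<Longrightarrow> norm (X 1 t - X 0 t) * exp (- a * t) \<le> K"
      using continuous_attains_sup[of "{0..T}" "\<lambda>t. norm (X 1 t - X 0 t) * exp (- a * t)"] True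
      by fastforce
    have K0: "K \<ge> 0" using order_trans[OF norm_ge_zero, of "X 1 0 - X 0 0" K] K[of 0] True by simp
    have le: "norm (X (Suc n) t - X n t) \<le> K * (1/2)^n * exp (a * t)" if "t \<in> {0..T}" for n t
      using that
    proof (induction n arbitrary: t)
      case 0
      then show ?case using K[of t] by (simp add: exp_minus field_simps)
    next
      case (Suc n)
      then show ?case using a[OF X X, of "Suc n" n "K * (1/2)^n" t] by (simp add: X_Suc)
    qed
    \<comment> \<open>The majorant must not depend on \<open>t\<close>; the absolute value appears
      because the contraction property leaves the sign of \<open>a\<close> open.\<close>
    have "norm (X (Suc n) t - X n t) \<le> K * (1/2)^n * exp (\<bar>a\<bar> * T)" if t: "t \<in> {0..T}" for n t
    proof -
      have "a * t \<le> \<bar>a\<bar> * T" using t by (intro mult_mono) auto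
      then show ?thesis
        using K0 by (intro order_trans[OF le[OF t]] mult_left_mono) auto
    qed
    then have "uniform_limit {0..T} (\<lambda>n t. \<Sum>i<n. X (Suc i) t - X i t) (\<lambda>t. \<Sum>i. X (Suc i) t - X i t) sequentially"
      by (rule Weierstrass_m_test[where M = "\<lambda>n. K * (1/2)^n * exp (\<bar>a\<bar> * T)"])
         (auto intro!: summable_mult summable_mult2 summable_geometric)
    then have "uniform_limit {0..T} (\<lambda>n t. X 0 t + (\<Sum>i<n. X (Suc i) t - X i t)) u sequentially"
      unfolding u_def by (intro uniform_limit_add uniform_limit_const)
    moreover have "X 0 t + (\<Sum>i<n. X (Suc i) t - X i t) = X n t" for n t
      using sum_lessThan_telescope[of "\<lambda>i. X i t" n] by simp
    ultimately show ?thesis by simp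
  qed auto
  have u: "continuous_on {0..} u"
    by (intro continuous_on_atLeastI uniform_limit_theorem[OF _ lim] always_eventually allI
        continuous_on_subset[OF X]) auto
  have "u T = ?\<Phi> u T" if T: "T \<ge> 0" for T
  proof -
    obtain a where a: "\<And>u w K t. continuous_on {0..} u \<Longrightarrow> continuous_on {0..} w \<Longrightarrow>
        (\<And>\<tau>. \<tau> \<in> {0..T} \<Longrightarrow> norm (u \<tau> - w \<tau>) \<le> K * exp (a * \<tau>)) \<Longrightarrow> t \<in> {0..T} \<Longrightarrow>
        norm (duhamel S F u0 u t - duhamel S F u0 w t) \<le> K / 2 * exp (a * t)"
      using duhamel_contraction[OF S F] by metis
    have "(\<lambda>n. X (Suc n) T) \<longlonglongrightarrow> ?\<Phi> u T"
    proof (rule tendstoI)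
      fix e :: real assume e: "e > 0"
      \<comment> \<open>Chosen so that \<open>K * exp (\<bar>a\<bar> * T)\<close> equals
        \<open>e\<close>; the second factor \<open>exp (- \<bar>a\<bar> * T)\<close> in the
        closeness requirement turns plain uniform closeness into a weighted one.\<close>
      define K where "K = e * exp (- \<bar>a\<bar> * T)"
      have K: "K > 0" using e by (simp add: K_def)
      have "\<forall>\<^sub>F n in sequentially. \<forall>t\<in>{0..T}. dist (X n t) (u t) < K * exp (- \<bar>a\<bar> * T)"
        using lim[of T] K unfolding uniform_limit_iff by simp
      then show "\<forall>\<^sub>F n in sequentially. dist (X (Suc n) T) (?\<Phi> u T) < e"
      proof eventually_elim
        case (elim n)
        have "norm (X n t - u t) \<le> K * exp (a * t)" if t: "t \<in> {0..T}" for t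
        proof -
          have "- (\<bar>a\<bar> * T) \<le> - (\<bar>a\<bar> * t)" using t by (simp add: mult_left_mono)
          also have "\<dots> \<le> a * t" using t mult_right_mono[of "- \<bar>a\<bar>" a t] by simp
          finally have "K * exp (- \<bar>a\<bar> * T) \<le> K * exp (a * t)" using K by simp
          then show ?thesis using elim[rule_format, OF t] by (simp add: dist_norm)
        qed
        then have "norm (X (Suc n) T - ?\<Phi> u T) \<le> K / 2 * exp (a * T)"
          unfolding X_Suc using T by (intro a X u) auto
        also have "\<dots> < K * exp (\<bar>a\<bar> * T)"
          using K T by (intro mult_less_le_imp_less) (auto intro: mult_right_mono)
        also have "\<dots> = e" by (simp add: K_def exp_minus)
        finally show ?case by (simp add: dist_norm)
      qed
    qed
    moreover have "(\<lambda>n. X (Suc n) T) \<longlonglongrightarrow> u T"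
      using tendsto_uniform_limitI[OF lim, of T T] T by (intro LIMSEQ_Suc[of "\<lambda>n. X n T"]) auto
    ultimately show ?thesis by (blast intro: LIMSEQ_unique)
  qed
  with u show ?thesis by blast
qed

section \<open>The target system\<close>

lemma bounded_linear_lipschitz_ex:
  assumes "bounded_linear f"
  shows "\<exists>L. L-lipschitz_on UNIV f"
  using bounded_linear.lipschitz_boundE[OF assms, of UNIV] by metis

lemma lipschitz_ex_compose:
  assumes "\<exists>L. L-lipschitz_on UNIV g" "\<exists>L. L-lipschitz_on UNIV f"
  shows "\<exists>L. L-lipschitz_on UNIV (\<lambda>x. g (f x))"
proof -
  obtain L M where L: "L-lipschitz_on UNIV g" and M: "M-lipschitz_on UNIV f" using assms by blast
  have "(L * M)-lipschitz_on UNIV (\<lambda>x. g (f x))"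
    by (rule lipschitz_on_compose2[OF M]) (use L lipschitz_on_subset in blast)
  then show ?thesis by blast
qed

lemma lipschitz_ex_add:
  fixes f g :: "'a::metric_space \<Rightarrow> 'b::real_normed_vector"
  assumes "\<exists>L. L-lipschitz_on UNIV f" "\<exists>L. L-lipschitz_on UNIV g"
  shows "\<exists>L. L-lipschitz_on UNIV (\<lambda>x. f x + g x)"
  using assms lipschitz_on_add by blast

lemma lipschitz_ex_diff:
  fixes f g :: "'a::metric_space \<Rightarrow> 'b::real_normed_vector"
  assumes "\<exists>L. L-lipschitz_on UNIV f" "\<exists>L. L-lipschitz_on UNIV g"
  shows "\<exists>L. L-lipschitz_on UNIV (\<lambda>x. f x - g x)"
  using assms lipschitz_on_diff by blast

lemma lipschitz_ex_scaleR:
  fixes f :: "'a::metric_space \<Rightarrow> 'b::real_normed_vector"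
  assumes "\<exists>L. L-lipschitz_on UNIV f"
  shows "\<exists>L. L-lipschitz_on UNIV (\<lambda>x. c *\<^sub>R f x)"
  using assms lipschitz_on_cmult by blast

lemma has_partials_on_triangle_continuous:
  assumes "has_partials_on_triangle k kx ky"
  shows "continuous_on triangle (\<lambda>(x, y). k x y)"
  unfolding continuous_on_eq_continuous_within
proof
  fix p assume "p \<in> triangle"
  moreover obtain x y where "p = (x, y)" by fastforce
  ultimately show "continuous (at p within triangle) (\<lambda>(x, y). k x y)"
    using assms has_derivative_continuous unfolding has_partials_on_triangle_def by fast
qed

lemma elliptic_state_lipschitz:
  assumes "\<And>n::nat. \<gamma> \<noteq> - (real n * pi)\<^sup>2" and "\<exists>L. L-lipschitz_on UNIV f3"
    and "continuous_on triangle (\<lambda>(x, y). l x y)"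
  shows "\<exists>L. L-lipschitz_on UNIV (original_state l)"
    and "\<exists>L. L-lipschitz_on UNIV (elliptic_state \<beta> \<gamma> f3 l)"
proof -
  show u: "\<exists>L. L-lipschitz_on UNIV (original_state l)"
    unfolding original_state_def
    by (intro lipschitz_ex_add bounded_linear_lipschitz_ex bounded_linear_volterra assms bounded_linear_ident)
  show "\<exists>L. L-lipschitz_on UNIV (elliptic_state \<beta> \<gamma> f3 l)"
    unfolding elliptic_state_def Let_def
    by (rule lipschitz_ex_compose[where g = "neumann_resolvent \<gamma>"])
       (intro bounded_linear_lipschitz_ex bounded_linear_neumann_resolvent assms
          lipschitz_ex_add lipschitz_ex_scaleR u lipschitz_ex_compose[OF assms(2)])+
qed

lemma target_nonlinearity_lipschitz:
  assumes "\<And>n::nat. \<gamma> \<noteq> - (real n * pi)\<^sup>2"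
    and f: "\<exists>L. L-lipschitz_on UNIV f1" "\<exists>L. L-lipschitz_on UNIV f2" "\<exists>L. L-lipschitz_on UNIV f3"
    and "continuous_on triangle (\<lambda>(x, y). k x y)" "continuous_on triangle (\<lambda>(x, y). l x y)"
  shows "\<exists>L. L-lipschitz_on UNIV (target_nonlinearity \<rho> \<alpha> \<beta> \<gamma> c1 f1 f2 f3 k l)"
proof -
  note u = elliptic_state_lipschitz(1)[OF assms(1) f(3) assms(6)]
    and v = elliptic_state_lipschitz(2)[OF assms(1) f(3) assms(6), where \<beta> = \<beta>]
  have k: "\<exists>L. L-lipschitz_on UNIV (volterra k)"
    by (intro bounded_linear_lipschitz_ex bounded_linear_volterra assms)
  note fu = lipschitz_ex_compose[OF f(1) u] and fv = lipschitz_ex_compose[OF f(2) v]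
  show ?thesis
    unfolding target_nonlinearity_def Let_def
    by (intro lipschitz_ex_add lipschitz_ex_diff lipschitz_ex_scaleR v fu fv lipschitz_ex_compose[OF k v]
        lipschitz_ex_compose[OF k fu] lipschitz_ex_compose[OF k fv]
        bounded_linear_lipschitz_ex bounded_linear_ident)
qed

text \<open>Functions of time are total, and \<open>mild_solution\<close> constrains them for
  \<open>t \<ge> 0\<close> only, so uniqueness means agreement there. The second component is a
  function of the first, which reduces existence and uniqueness to the fixed point equation for
  \<open>ut\<close>.\<close>

theorem theorem3:
  fixes \<rho> \<alpha> \<beta> \<gamma> c1 :: real
    and f1 f2 f3 :: "l2 \<Rightarrow> l2"
    and k l :: "real \<Rightarrow> real \<Rightarrow> real"
    and S :: "real \<Rightarrow> l2 \<Rightarrow> l2"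
    and ut0 v0 :: l2
  assumes "\<And>n::nat. \<gamma> \<noteq> - (real n * pi)\<^sup>2"
    and "c1 > 0"
    and "\<exists>L. L-lipschitz_on UNIV f1" and "f1 0 = 0"
    and "\<exists>L. L-lipschitz_on UNIV f2" and "f2 0 = 0"
    and "\<exists>L. L-lipschitz_on UNIV f3" and "f3 0 = 0"
    and "direct_kernel c1 k"
    and "inverse_kernel c1 l"
    and "generated_by S neumann_domain neumann_laplacian"
    and "v0 = elliptic_state \<beta> \<gamma> f3 l ut0"
  shows "\<exists>ut v.
    mild_solution S (target_nonlinearity \<rho> \<alpha> \<beta> \<gamma> c1 f1 f2 f3 k l) (elliptic_state \<beta> \<gamma> f3 l) ut0 ut v \<and>
    ut 0 = ut0 \<and> v 0 = v0 \<and>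
    (\<forall>ut' v'.
      mild_solution S (target_nonlinearity \<rho> \<alpha> \<beta> \<gamma> c1 f1 f2 f3 k l) (elliptic_state \<beta> \<gamma> f3 l) ut0 ut' v' \<longrightarrow>
      (\<forall>t\<ge>0. ut' t = ut t \<and> v' t = v t))"
proof -
  let ?\<Lambda> = "target_nonlinearity \<rho> \<alpha> \<beta> \<gamma> c1 f1 f2 f3 k l" and ?E = "elliptic_state \<beta> \<gamma> f3 l"
  have S: "C0_semigroup S" using assms(11) by (simp add: generated_by_def)
  have k: "continuous_on triangle (\<lambda>(x, y). k x y)"
    using assms(9) has_partials_on_triangle_continuous unfolding direct_kernel_def by blast
  have l: "continuous_on triangle (\<lambda>(x, y). l x y)"
    using assms(10) has_partials_on_triangle_continuous unfolding inverse_kernel_def by blast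
  obtain L where \<Lambda>: "L-lipschitz_on UNIV ?\<Lambda>"
    using target_nonlinearity_lipschitz[OF assms(1,3,5,7) k l] by blast
  have E: "continuous_on UNIV ?E"
    using elliptic_state_lipschitz(2)[OF assms(1,7) l] lipschitz_on_continuous_on by blast
  obtain ut where ut: "continuous_on {0..} ut" "\<And>t. t \<ge> 0 \<Longrightarrow> ut t = duhamel S ?\<Lambda> ut0 ut t"
    using duhamel_fixpoint_exists[OF S \<Lambda>] by blast
  have "mild_solution S ?\<Lambda> ?E ut0 ut (\<lambda>t. ?E (ut t))"
    using ut continuous_on_compose2[OF E ut(1)] by (simp add: mild_solution_def duhamel_def)
  moreover have "ut 0 = ut0"
    using ut(2)[of 0] S by (simp add: duhamel_def C0_semigroup_def)
  moreover have "ut' t = ut t \<and> v' t = ?E (ut t)"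
    if m: "mild_solution S ?\<Lambda> ?E ut0 ut' v'" and t: "t \<ge> 0" for ut' v' t
  proof -
    have "ut' t = ut t"
      using m by (intro duhamel_unique[OF S \<Lambda> _ _ ut t]) (auto simp: mild_solution_def duhamel_def)
    then show ?thesis using m t by (simp add: mild_solution_def)
  qed
  ultimately show ?thesis using assms(12) by blast
qed

end
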